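(* Let $X$ be a compact metric space endowed with a reference Borel probability measure $\mu$, and let $\Lambda$ be a set of continuous self-mappings of $X$, endowed with a topology finer than the $C^0$ topology. Let $\mathcal{U}$ be the interior in $\Lambda$ of the set of statistically unstable maps $f\in\Lambda$. Then the set of non-statistical maps in $\mathcal{U}$ is a Baire generic subset of $\mathcal{U}$.
   Context: "Finer" means not necessarily strictly finer. $\mathcal{M}_1(X)$ is the space of Borel probability measures on $X$ with the Wasserstein distance $d_w(\nu_1,\nu_2)=\inf_{\zeta}\int_{X\times X}d(x,y)\,d\zeta$, the infimum over all couplings $\zeta$ of $\nu_1,\nu_2$ (it induces the weak-$*$ topology). The empirical measures are $e_n^f(x)=\frac1n\sum_{i=0}^{n-1}\delta_{f^i(x)}$, $n\ge1$. A map $f$ is non-statistical if the set of points $x\in X$ for which $\{e_n^f(x)\}_n$ does not converge has positive $\mu$-measure. For $h,g\in\Lambda$ and $N\in\mathbb{N}$, put $\Delta_N(h,g)=\int_X\sup_{n,m\ge N}d_w(e_n^h(x),e_m^g(x))\,d\mu(x)$, and $\Delta(f)=\lim_{N\to\infty}\limsup_{h,g\to f;\ h,g\in\Lambda}\Delta_N(h,g)$, where $\limsup_{h,g\to f}$ means the infimum over neighborhoods $V$ of $f$ in $\Lambda$ of the supremum over $h,g\in V$. A map $f\in\Lambda$ is statistically unstable if $\Delta(f)>0$. A subset of a topological space is Baire generic if it contains a countable intersection of open dense subsets. *)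

theory Defs
  imports "HOL-Probability.Probability"
begin

class compact_metric_space = metric_space +
  assumes compact_UNIV: "compact (UNIV :: 'a set)"

text \<open>
  Compact metric spaces are Polish. The instance makes the library facts on second countable
  spaces available, e.g. that the Borel sets of a product are the product of the Borel sets.
\<close>

instance compact_metric_space \<subseteq> polish_space
proof
  fix X :: "nat \<Rightarrow> 'a"
  assume "Cauchy X"
  then show "convergent X"
    using completeE[OF compact_imp_complete[OF compact_UNIV], of X] unfolding convergent_def by auto
next
  have "\<exists>K :: 'a set. finite K \<and> UNIV \<subseteq> (\<Union>x\<in>K. ball x (1 / Suc n))" for n
    using compact_UNIV unfolding compact_eq_totally_bounded
    by (metis of_nat_0_less_iff zero_less_Suc zero_less_divide_1_iff)
  then obtain K :: "nat \<Rightarrow> 'a set"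
    where fin: "\<And>n. finite (K n)" and cov: "\<And>n. UNIV \<subseteq> (\<Union>x\<in>K n. ball x (1 / Suc n))"
    by metis
  define B where "B = (\<Union>n. (\<lambda>x. ball x (1 / Suc n)) ` K n)"
  have "countable B"
    unfolding B_def using fin by (auto intro: countable_finite)
  moreover have "topological_basis B"
  proof (rule topological_basisI)
    show "open S" if "S \<in> B" for S
      using that by (auto simp: B_def)
    fix U and x :: 'a
    assume "open U" "x \<in> U"
    then obtain e where e: "e > 0" "ball x e \<subseteq> U"
      by (auto simp: open_contains_ball)
    then obtain n where n: "inverse (real (Suc n)) < e / 2"
      using reals_Archimedean[of "e / 2"] by auto
    obtain y where y: "y \<in> K n" "x \<in> ball y (1 / Suc n)"
      using cov[of n] by blast
    have "ball y (1 / Suc n) \<subseteq> ball x e"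
    proof
      fix z assume "z \<in> ball y (1 / Suc n)"
      then have "dist x z < e"
        using y(2) n dist_triangle[of x z y] by (simp add: dist_commute inverse_eq_divide)
      then show "z \<in> ball x e" by simp
    qed
    then show "\<exists>S\<in>B. x \<in> S \<and> S \<subseteq> U"
      using y e(2) unfolding B_def by blast
  qed
  ultimately show "\<exists>B :: 'a set set. countable B \<and> open = generate_topology B"
    using topological_basis_imp_subbasis by blast
qed

definition C0_topology :: "('a :: compact_metric_space \<Rightarrow> 'a) topology" where
  "C0_topology = mtopology_of (cfunspace euclidean euclidean_metric)"

lemma topspace_C0_topology: "topspace C0_topology = {f. continuous_on UNIV f}"
proof -
  have "bounded (range f)" if "continuous_on UNIV f" for f :: "'a :: compact_metric_space \<Rightarrow> 'a"
    using that compact_UNIV compact_continuous_image compact_imp_bounded by blast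
  then show ?thesis
    by (auto simp: C0_topology_def)
qed

definition finer_topology :: "'b topology \<Rightarrow> 'b topology \<Rightarrow> bool" where
  "finer_topology T S \<longleftrightarrow> topspace T = topspace S \<and> (\<forall>U. openin S U \<longrightarrow> openin T U)"

definition borel_prob_measures :: "'a :: topological_space measure set" where
  "borel_prob_measures = {\<nu>. sets \<nu> = sets borel \<and> prob_space \<nu>}"

definition couplings ::
  "'a :: topological_space measure \<Rightarrow> 'a measure \<Rightarrow> ('a \<times> 'a) measure set" where
  "couplings \<nu>1 \<nu>2 =
    {\<zeta> \<in> borel_prob_measures. distr \<zeta> borel fst = \<nu>1 \<and> distr \<zeta> borel snd = \<nu>2}"

definition wasserstein :: "'a :: compact_metric_space measure \<Rightarrow> 'a measure \<Rightarrow> real" where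
  "wasserstein \<nu>1 \<nu>2 = (INF \<zeta>\<in>couplings \<nu>1 \<nu>2. \<integral>(x, y). dist x y \<partial>\<zeta>)"

definition empirical_measure ::
  "('a :: topological_space \<Rightarrow> 'a) \<Rightarrow> nat \<Rightarrow> 'a \<Rightarrow> 'a measure" where
  "empirical_measure f n x =
    measure_of UNIV (sets borel)
      (\<lambda>A. (\<Sum>i<n. emeasure (return borel ((f ^^ i) x)) A) / of_nat n)"

text \<open>The set function in the definition is countably additive, so it is the resulting measure.\<close>

lemma sets_empirical_measure [simp, measurable_cong]:
  "sets (empirical_measure f n x) = sets borel"
  unfolding empirical_measure_def using sets.sets_measure_of_eq[of borel] by simp

lemma emeasure_empirical_measure:
  assumes "A \<in> sets borel"
  shows "emeasure (empirical_measure f n x) A =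
    (\<Sum>i<n. emeasure (return borel ((f ^^ i) x)) A) / of_nat n"
proof (rule emeasure_measure_of[OF empirical_measure_def])
  show "countably_additive (sets (empirical_measure f n x))
    (\<lambda>A. (\<Sum>i<n. emeasure (return borel ((f ^^ i) x)) A) / of_nat n)"
    unfolding countably_additive_def
  proof (intro allI impI)
    fix F :: "nat \<Rightarrow> 'a set"
    assume F: "range F \<subseteq> sets (empirical_measure f n x)" "disjoint_family F"
    have "(\<Sum>k. (\<Sum>i<n. emeasure (return borel ((f ^^ i) x)) (F k)) / of_nat n) =
        (\<Sum>i<n. \<Sum>k. emeasure (return borel ((f ^^ i) x)) (F k)) / of_nat n"
      by (simp add: suminf_sum divide_ennreal_def)
    also have "\<dots> = (\<Sum>i<n. emeasure (return borel ((f ^^ i) x)) (\<Union>k. F k)) / of_nat n"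
      using F by (subst suminf_emeasure) auto
    finally show "(\<Sum>k. (\<Sum>i<n. emeasure (return borel ((f ^^ i) x)) (F k)) / of_nat n) =
        (\<Sum>i<n. emeasure (return borel ((f ^^ i) x)) (\<Union>k. F k)) / of_nat n" .
  qed
qed (use assms in \<open>auto simp: positive_def\<close>)

lemma empirical_measure_in_borel_prob_measures:
  assumes "n \<ge> 1"
  shows "empirical_measure f n x \<in> borel_prob_measures"
proof -
  have "space (empirical_measure f n x) = UNIV"
    using sets_eq_imp_space_eq[OF sets_empirical_measure] by simp
  then have "emeasure (empirical_measure f n x) (space (empirical_measure f n x)) = 1"
    using assms by (simp add: emeasure_empirical_measure ennreal_divide_self of_nat_less_top)
  then show ?thesis
    by (auto simp: borel_prob_measures_def intro: prob_spaceI)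
qed

definition empirical_convergent :: "('a :: compact_metric_space \<Rightarrow> 'a) \<Rightarrow> 'a \<Rightarrow> bool" where
  "empirical_convergent f x \<longleftrightarrow>
    (\<exists>\<nu>\<in>borel_prob_measures. (\<lambda>n. wasserstein (empirical_measure f n x) \<nu>) \<longlonglongrightarrow> 0)"

text \<open>For continuous \<open>f\<close> the set of points of non-convergence is Borel.\<close>

definition non_statistical ::
  "'a :: compact_metric_space measure \<Rightarrow> ('a \<Rightarrow> 'a) \<Rightarrow> bool" where
  "non_statistical \<mu> f \<longleftrightarrow> emeasure \<mu> {x. \<not> empirical_convergent f x} > 0"

text \<open>
  Empirical measures are defined for positive times only, so the times also range over positive
  numbers when \<open>N = 0\<close>. For continuous \<open>h\<close> and \<open>g\<close> the integrand is Borel and bounded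
  by the diameter of the space, and the suprema and infima below are taken over
  nonempty bounded sets of reals.
\<close>

definition Delta_N ::
  "'a :: compact_metric_space measure \<Rightarrow> nat \<Rightarrow> ('a \<Rightarrow> 'a) \<Rightarrow> ('a \<Rightarrow> 'a) \<Rightarrow> real" where
  "Delta_N \<mu> N h g =
    (\<integral>x. (SUP (n, m) \<in> {max N 1..} \<times> {max N 1..}.
      wasserstein (empirical_measure h n x) (empirical_measure g m x)) \<partial>\<mu>)"

definition neighbourhoods :: "'b topology \<Rightarrow> 'b \<Rightarrow> 'b set set" where
  "neighbourhoods T p = {V. V \<subseteq> topspace T \<and> p \<in> T interior_of V}"

definition Delta ::
  "'a :: compact_metric_space measure \<Rightarrow> ('a \<Rightarrow> 'a) topology \<Rightarrow> ('a \<Rightarrow> 'a) \<Rightarrow> real" where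
  "Delta \<mu> T f =
    lim (\<lambda>N. INF V\<in>neighbourhoods T f. SUP (h, g)\<in>V \<times> V. Delta_N \<mu> N h g)"

definition statistically_unstable ::
  "'a :: compact_metric_space measure \<Rightarrow> ('a \<Rightarrow> 'a) topology \<Rightarrow> ('a \<Rightarrow> 'a) \<Rightarrow> bool" where
  "statistically_unstable \<mu> T f \<longleftrightarrow> f \<in> topspace T \<and> Delta \<mu> T f > 0"

definition baire_generic_in :: "'b topology \<Rightarrow> 'b set \<Rightarrow> bool" where
  "baire_generic_in S A \<longleftrightarrow> A \<subseteq> topspace S \<and>
    (\<exists>\<G>. countable \<G> \<and> (\<forall>G\<in>\<G>. openin S G \<and> S closure_of G = topspace S) \<and>
      topspace S \<inter> \<Inter>\<G> \<subseteq> A)"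

end

theory Submission
  imports Defs
begin

text \<open>
  Call the oscillation of \<open>f\<close> at \<open>x\<close> from time \<open>N\<close> the supremum of the distances between
  \<open>e_n^f(x)\<close> and \<open>e_m^f(x)\<close> over \<open>n, m \<ge> N\<close>; its integral is \<open>Delta_N(f, f)\<close>. The proof compares
  the two-map quantity \<open>Delta_N(h, g)\<close> with this one-map quantity.

  If \<open>Delta_N(F, F) \<le> c\<close> for all \<open>F\<close> near \<open>f\<close>, then \<open>Delta(f) \<le> 2c\<close>
  (\<open>Delta_le_if_self_oscillation_le\<close>): to pass from \<open>e_n^h(x)\<close> to \<open>e_m^g(x)\<close>, go through
  \<open>e_N^h(x)\<close> and \<open>e_N^g(x)\<close>. These two are close to each other, because \<open>N\<close> is fixed and
  \<open>h\<close> and \<open>g\<close> are uniformly close. Consequently, if \<open>Delta(f) \<ge> c > 0\<close>, every neighbourhood of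
  \<open>f\<close> contains, for each \<open>N\<close>, a map \<open>F\<close> with \<open>Delta_N(F, F) > c/3\<close>. So the set of maps that
  satisfy \<open>Delta_N(F, F) > c/3\<close> or \<open>Delta(F) < c\<close> is dense. It is also open, because
  \<open>F \<mapsto> Delta_N(F, F)\<close> is lower semicontinuous, being the supremum of the continuous functions obtained by
  restricting the times to finite ranges, and \<open>Delta\<close> is upper semicontinuous. Intersect these sets over
  \<open>c = 1, 1/2, 1/3, ...\<close> and all \<open>N\<close>. A map \<open>f\<close> in the intersection with \<open>Delta(f) > 0\<close>
  satisfies \<open>Delta_N(f, f) > c/3\<close> for all \<open>N\<close> and some fixed \<open>c\<close>, and by dominated convergence
  the oscillations cannot tend to 0 almost everywhere
  (\<open>non_statistical_if_Delta_N_bounded_below\<close>).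

  This uses two facts on the Wasserstein distance on a compact metric space: the triangle inequality
  and completeness. Completeness turns "the oscillation tends to 0" into "the empirical measures
  converge", which also shows that the set of points of non-convergence is Borel. Both facts rest on
  an approximate disintegration of couplings (\<open>approximate_disintegration\<close>): up to an arbitrarily
  small cost, a coupling can be replaced by a Markov kernel, obtained by conditioning on a finite
  partition. Extending a coupling by a kernel gives the triangle inequality. Composing the kernels along a
  fast Cauchy sequence of measures gives a Markov chain whose paths converge almost surely, and the
  law of the limit point is the limit measure.
\<close>

section \<open>Couplings and the Wasserstein distance\<close>

lemma dist_le_diameter:
  fixes x y :: "'a :: compact_metric_space"
  shows "dist x y \<le> diameter (UNIV :: 'a set)"
  by (intro diameter_bounded_bound compact_imp_bounded compact_UNIV UNIV_I)

lemma measurable_fst_borel [measurable]: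
  "fst \<in> borel_measurable (borel :: ('a :: topological_space \<times> 'b :: topological_space) measure)"
  by (intro borel_measurable_continuous_onI continuous_intros)

lemma measurable_snd_borel [measurable]:
  "snd \<in> borel_measurable (borel :: ('a :: topological_space \<times> 'b :: topological_space) measure)"
  by (intro borel_measurable_continuous_onI continuous_intros)

lemma diameter_UNIV_nonneg: "0 \<le> diameter (UNIV :: 'a :: compact_metric_space set)"
  using diameter_ge_0[OF compact_imp_bounded[OF compact_UNIV]] .

lemma integrable_dist:
  fixes Y Z :: "'b \<Rightarrow> 'a :: compact_metric_space"
  assumes "prob_space M" and [measurable]: "Y \<in> borel_measurable M" "Z \<in> borel_measurable M"
  shows "integrable M (\<lambda>\<omega>. dist (Y \<omega>) (Z \<omega>))"
proof -
  interpret prob_space M by fact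
  show ?thesis
    by (rule integrable_const_bound[of _ "diameter (UNIV :: 'a set)"]) (auto simp: dist_le_diameter)
qed

lemma borel_prob_measuresD:
  assumes "\<nu> \<in> borel_prob_measures"
  shows "prob_space \<nu>" and "sets \<nu> = sets borel" and "space \<nu> = UNIV"
    and "measurable \<nu> N = measurable borel N"
proof -
  show *: "prob_space \<nu>" "sets \<nu> = sets borel"
    using assms by (auto simp: borel_prob_measures_def)
  show "space \<nu> = UNIV" "measurable \<nu> N = measurable borel N"
    using sets_eq_imp_space_eq[OF *(2)] measurable_cong_sets[OF *(2) refl] by auto
qed

lemma distr_in_borel_prob_measures:
  assumes "prob_space M" "Y \<in> borel_measurable M"
  shows "distr M borel Y \<in> borel_prob_measures"
  using assms by (simp add: borel_prob_measures_def prob_space.prob_space_distr)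

lemma couplingsD:
  assumes "\<zeta> \<in> couplings \<nu>1 \<nu>2"
  shows "\<zeta> \<in> borel_prob_measures" and "distr \<zeta> borel fst = \<nu>1" and "distr \<zeta> borel snd = \<nu>2"
  using assms by (auto simp: couplings_def)

lemma cost_nonneg: "0 \<le> (\<integral>(x, y). dist x y \<partial>\<zeta>)"
  by (rule integral_nonneg_AE) auto

lemma wasserstein_le_coupling:
  assumes "\<zeta> \<in> couplings \<nu>1 \<nu>2"
  shows "wasserstein \<nu>1 \<nu>2 \<le> (\<integral>(x, y). dist x y \<partial>\<zeta>)"
  unfolding wasserstein_def
  by (rule cINF_lower[OF _ assms]) (auto intro!: bdd_belowI[of _ 0] cost_nonneg)

text \<open>
  Upper bounds for the distance are obtained from pairs of random variables on any probability space:
  their joint law is a coupling.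
\<close>

lemma wasserstein_le_expectation:
  fixes Y Z :: "'b \<Rightarrow> 'a :: compact_metric_space"
  assumes "prob_space M" and [measurable]: "Y \<in> borel_measurable M" "Z \<in> borel_measurable M"
  shows "wasserstein (distr M borel Y) (distr M borel Z) \<le> (\<integral>\<omega>. dist (Y \<omega>) (Z \<omega>) \<partial>M)"
proof -
  let ?\<zeta> = "distr M borel (\<lambda>\<omega>. (Y \<omega>, Z \<omega>))"
  have "?\<zeta> \<in> couplings (distr M borel Y) (distr M borel Z)"
    using assms(1)
    by (auto simp: couplings_def distr_distr comp_def intro!: distr_in_borel_prob_measures)
  from wasserstein_le_coupling[OF this] show ?thesis
    by (simp add: integral_distr split_beta')
qed

lemma product_in_couplings:
  fixes \<nu>1 \<nu>2 :: "'a :: compact_metric_space measure"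
  assumes "\<nu>1 \<in> borel_prob_measures" "\<nu>2 \<in> borel_prob_measures"
  shows "\<nu>1 \<Otimes>\<^sub>M \<nu>2 \<in> couplings \<nu>1 \<nu>2"
proof -
  interpret p1: prob_space \<nu>1 by (rule borel_prob_measuresD) fact
  interpret p2: prob_space \<nu>2 by (rule borel_prob_measuresD) fact
  interpret pair_prob_space \<nu>1 \<nu>2 ..
  note [measurable_cong] = assms[THEN borel_prob_measuresD(2)]
  have "distr (\<nu>1 \<Otimes>\<^sub>M \<nu>2) borel fst = distr (\<nu>1 \<Otimes>\<^sub>M \<nu>2) \<nu>1 fst"
    "distr (\<nu>1 \<Otimes>\<^sub>M \<nu>2) borel snd = distr (\<nu>1 \<Otimes>\<^sub>M \<nu>2) \<nu>2 snd"
    using assms[THEN borel_prob_measuresD(2)] by (auto intro!: distr_cong)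
  moreover have "distr (\<nu>1 \<Otimes>\<^sub>M \<nu>2) \<nu>2 snd = \<nu>2"
  proof (rule measure_eqI)
    fix A assume A: "A \<in> sets (distr (\<nu>1 \<Otimes>\<^sub>M \<nu>2) \<nu>2 snd)"
    then have "snd -` A \<inter> space (\<nu>1 \<Otimes>\<^sub>M \<nu>2) = space \<nu>1 \<times> A"
      by (auto simp: space_pair_measure dest: sets.sets_into_space)
    then show "emeasure (distr (\<nu>1 \<Otimes>\<^sub>M \<nu>2) \<nu>2 snd) A = emeasure \<nu>2 A"
      using A by (simp add: emeasure_distr p2.emeasure_pair_measure_Times p1.emeasure_space_1)
  qed simp
  moreover have "distr (\<nu>1 \<Otimes>\<^sub>M \<nu>2) \<nu>1 fst = \<nu>1"
    by (rule p2.distr_pair_fst)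
  moreover have "sets (\<nu>1 \<Otimes>\<^sub>M \<nu>2) = sets borel"
    using assms[THEN borel_prob_measuresD(2)] by (metis borel_prod sets_pair_measure_cong)
  ultimately show ?thesis
    using prob_space_axioms by (auto simp: couplings_def borel_prob_measures_def)
qed

lemma near_optimal_coupling:
  fixes \<nu>1 \<nu>2 :: "'a :: compact_metric_space measure"
  assumes "\<nu>1 \<in> borel_prob_measures" "\<nu>2 \<in> borel_prob_measures" "wasserstein \<nu>1 \<nu>2 < c"
  obtains \<zeta> where "\<zeta> \<in> couplings \<nu>1 \<nu>2" "(\<integral>(x, y). dist x y \<partial>\<zeta>) < c"
proof -
  have "couplings \<nu>1 \<nu>2 \<noteq> {}"
    using product_in_couplings assms by blast
  moreover have "bdd_below ((\<lambda>\<zeta>. \<integral>(x, y). dist x y \<partial>\<zeta>) ` couplings \<nu>1 \<nu>2)"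
    by (auto intro!: bdd_belowI[of _ 0] cost_nonneg)
  ultimately show ?thesis
    using that assms(3) unfolding wasserstein_def by (subst (asm) cINF_less_iff) auto
qed

lemma wasserstein_nonneg:
  fixes \<nu>1 \<nu>2 :: "'a :: compact_metric_space measure"
  assumes "\<nu>1 \<in> borel_prob_measures" "\<nu>2 \<in> borel_prob_measures"
  shows "0 \<le> wasserstein \<nu>1 \<nu>2"
  using near_optimal_coupling[OF assms, of 0] cost_nonneg by (metis not_le)

lemma wasserstein_le_diameter:
  fixes \<nu>1 \<nu>2 :: "'a :: compact_metric_space measure"
  assumes "\<nu>1 \<in> borel_prob_measures" "\<nu>2 \<in> borel_prob_measures"
  shows "wasserstein \<nu>1 \<nu>2 \<le> diameter (UNIV :: 'a set)"
proof -
  let ?\<zeta> = "\<nu>1 \<Otimes>\<^sub>M \<nu>2"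
  have \<zeta>: "?\<zeta> \<in> couplings \<nu>1 \<nu>2" by (rule product_in_couplings) fact+
  note * = couplingsD(1)[OF \<zeta>, THEN borel_prob_measuresD(1)]
  interpret prob_space ?\<zeta> by (rule *)
  note [measurable_cong] = couplingsD(1)[OF \<zeta>, THEN borel_prob_measuresD(2)]
  have "(\<integral>z. dist (fst z) (snd z) \<partial>?\<zeta>) \<le> (\<integral>z. diameter (UNIV :: 'a set) \<partial>?\<zeta>)"
    by (rule integral_mono[OF integrable_dist[OF *]]) (auto simp: dist_le_diameter)
  then show ?thesis
    using wasserstein_le_coupling[OF \<zeta>] by (simp add: prob_space split_beta')
qed

lemma wasserstein_commute:
  fixes \<nu>1 \<nu>2 :: "'a :: compact_metric_space measure"
  assumes "\<nu>1 \<in> borel_prob_measures" "\<nu>2 \<in> borel_prob_measures"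
  shows "wasserstein \<nu>1 \<nu>2 = wasserstein \<nu>2 \<nu>1"
proof -
  have "wasserstein b a \<le> wasserstein a b"
    if ab: "a \<in> borel_prob_measures" "b \<in> borel_prob_measures" for a b :: "'a measure"
  proof (rule dense_ge)
    fix c assume "wasserstein a b < c"
    then obtain \<zeta> where \<zeta>: "\<zeta> \<in> couplings a b" "(\<integral>(x, y). dist x y \<partial>\<zeta>) < c"
      using near_optimal_coupling[OF ab] by metis
    note [measurable_cong] = couplingsD(1)[OF \<zeta>(1), THEN borel_prob_measuresD(2)]
    have "wasserstein (distr \<zeta> borel snd) (distr \<zeta> borel fst) \<le> (\<integral>z. dist (snd z) (fst z) \<partial>\<zeta>)"
      using couplingsD(1)[OF \<zeta>(1)] by (intro wasserstein_le_expectation borel_prob_measuresD(1)) auto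
    with \<zeta> couplingsD[OF \<zeta>(1)] show "wasserstein b a \<le> c"
      by (simp add: split_beta' dist_commute)
  qed
  from this[OF assms] this[OF assms(2,1)] show ?thesis by simp
qed

text \<open>
  Finite-valued maps make conditioning elementary: all fibres of positive measure can be treated by
  hand, and the remaining ones form a null set.
\<close>

lemma simple_approximation_of_identity:
  fixes \<nu> :: "'a :: compact_metric_space measure"
  assumes \<nu>: "\<nu> \<in> borel_prob_measures" and "\<epsilon> > 0"
  obtains T :: "'a \<Rightarrow> 'a" where "simple_function borel T" "(\<integral>\<^sup>+z. dist (T z) z \<partial>\<nu>) < ennreal \<epsilon>"
proof -
  interpret prob_space \<nu> by (rule borel_prob_measuresD) fact
  note [measurable_cong] = borel_prob_measuresD(2)[OF \<nu>]
  obtain F :: "nat \<Rightarrow> 'a \<Rightarrow> 'a" where F: "\<And>i. simple_function borel (F i)" "\<And>x. (\<lambda>i. F i x) \<longlonglongrightarrow> x"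
    using borel_measurable_implies_sequence_metric[of "\<lambda>x :: 'a. x" borel undefined] by auto
  have [measurable]: "F i \<in> borel_measurable borel" for i
    by (rule borel_measurable_simple_function) (rule F)
  have "(\<lambda>i. \<integral>\<^sup>+z. ennreal (dist (F i z) z) \<partial>\<nu>) \<longlonglongrightarrow> (\<integral>\<^sup>+z. 0 \<partial>\<nu>)"
  proof (rule nn_integral_dominated_convergence[where w="\<lambda>_. ennreal (diameter (UNIV :: 'a set))"])
    show "AE z in \<nu>. (\<lambda>i. ennreal (dist (F i z) z)) \<longlonglongrightarrow> 0"
    proof (rule AE_I2)
      fix z
      have "(\<lambda>i. dist (F i z) z) \<longlonglongrightarrow> 0"
        by (rule iffD1[OF tendsto_dist_iff F(2)])
      from tendsto_ennrealI[OF this] show "(\<lambda>i. ennreal (dist (F i z) z)) \<longlonglongrightarrow> 0"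
        by simp
    qed
    show "AE z in \<nu>. ennreal (dist (F j z) z) \<le> ennreal (diameter (UNIV :: 'a set))" for j
      by (intro AE_I2 ennreal_leI dist_le_diameter)
    show "(\<integral>\<^sup>+z. ennreal (diameter (UNIV :: 'a set)) \<partial>\<nu>) < \<infinity>"
      by (simp add: emeasure_space_1)
  qed (measurable)
  then have "(\<lambda>i. \<integral>\<^sup>+z. dist (F i z) z \<partial>\<nu>) \<longlonglongrightarrow> 0"
    by simp
  from order_tendstoD(2)[OF this, of "ennreal \<epsilon>"] obtain i where "(\<integral>\<^sup>+z. dist (F i z) z \<partial>\<nu>) < ennreal \<epsilon>"
    using \<open>\<epsilon> > 0\<close> by (auto simp: eventually_sequentially)
  with F(1) that show ?thesis by blast
qed

section \<open>Approximate disintegration and the triangle inequality\<close>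

lemma nn_integral_dist_coupling:
  fixes \<zeta> :: "('a :: compact_metric_space \<times> 'a) measure"
  assumes "\<zeta> \<in> borel_prob_measures"
  shows "(\<integral>\<^sup>+q. dist (fst q) (snd q) \<partial>\<zeta>) = ennreal (\<integral>(x, y). dist x y \<partial>\<zeta>)"
proof -
  note [measurable_cong] = borel_prob_measuresD(2)[OF assms]
  have "integrable \<zeta> (\<lambda>q. dist (fst q) (snd q))"
    by (rule integrable_dist[OF borel_prob_measuresD(1)[OF assms]]) measurable
  then show ?thesis
    by (simp add: nn_integral_eq_integral split_beta')
qed

text \<open>
  Conditioning on the value of the first coordinate is
  replaced by conditioning on its cell \<open>{z'. T z' = T z}\<close>, where \<open>T\<close> is a finite-valued map close to
  the identity: \<open>K z\<close> is the law of the second coordinate given that the first one lies in the cell of \<open>z\<close>. The second marginal is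
  preserved exactly. The cost grows because the conditional law starts from another point of the
  cell, but the detour through the common value of \<open>T\<close> costs at most twice the mean of
  \<open>dist (T z) z\<close>.
\<close>

lemma approximate_disintegration:
  fixes \<zeta> :: "('a :: compact_metric_space \<times> 'a) measure"
  assumes \<zeta>: "\<zeta> \<in> borel_prob_measures" and "\<epsilon> > 0"
  obtains K where "K \<in> borel \<rightarrow>\<^sub>M prob_algebra borel"
    and "distr \<zeta> borel fst \<bind> K = distr \<zeta> borel snd"
    and "(\<integral>\<^sup>+z. \<integral>\<^sup>+w. dist z w \<partial>K z \<partial>distr \<zeta> borel fst)
      \<le> (\<integral>\<^sup>+q. dist (fst q) (snd q) \<partial>\<zeta>) + ennreal \<epsilon>"
proof -
  note [measurable_cong] = borel_prob_measuresD(2)[OF \<zeta>]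
  interpret \<zeta>: prob_space \<zeta> by (rule borel_prob_measuresD) fact
  define \<nu> where "\<nu> = distr \<zeta> borel fst"
  have \<nu>: "\<nu> \<in> borel_prob_measures"
    unfolding \<nu>_def by (rule distr_in_borel_prob_measures[OF borel_prob_measuresD(1)[OF \<zeta>]]) measurable
  have sets_\<nu>[measurable_cong]: "sets \<nu> = sets borel" by (simp add: \<nu>_def)
  interpret \<nu>: prob_space \<nu> by (rule borel_prob_measuresD) fact
  interpret \<nu>\<zeta>: pair_sigma_finite \<nu> \<zeta> ..
  obtain T :: "'a \<Rightarrow> 'a" where T: "simple_function borel T" and
    T_close: "(\<integral>\<^sup>+z. dist (T z) z \<partial>\<nu>) < ennreal (\<epsilon> / 2)"
    using simple_approximation_of_identity[OF \<nu>, of "\<epsilon> / 2"] \<open>\<epsilon> > 0\<close> by auto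
  have T_cs[measurable]: "T \<in> borel \<rightarrow>\<^sub>M count_space UNIV"
    using T by (rule measurable_simple_function)
  have T_borel[measurable]: "T \<in> borel_measurable borel"
    using T by (rule borel_measurable_simple_function)
  have finite_T: "finite (range T)"
    using simple_functionD(1)[OF T] by simp
  define A where "A t = {q :: 'a \<times> 'a. T (fst q) = t}" for t
  define p where "p t = emeasure \<zeta> (A t)" for t
  have A_sets[measurable]: "A t \<in> sets borel" for t
  proof -
    have "(\<lambda>q :: 'a \<times> 'a. T (fst q)) -` {t} \<inter> space borel \<in> sets borel"
      by (rule measurable_sets[of _ _ "count_space UNIV"]) auto
    then show ?thesis
      by (simp add: A_def vimage_def)
  qed
  have p_\<nu>: "p t = emeasure \<nu> {z. T z = t}" for t
  proof -
    have "{z. T z = t} \<in> sets borel"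
      using measurable_sets[OF T_cs, of "{t}"] by (simp add: vimage_def)
    then show ?thesis
      using borel_prob_measuresD(3)[OF \<zeta>] by (simp add: \<nu>_def p_def A_def emeasure_distr vimage_def)
  qed
  have p_T[measurable]: "(\<lambda>z. p (T z)) \<in> borel_measurable borel"
    by (rule measurable_compose[OF T_cs]) simp
  have p_finite: "p t \<noteq> \<infinity>" for t
    unfolding p_def by simp

  \<comment> \<open>Only finitely many cells are null, so almost every point lies in a cell of positive measure.\<close>
  have AE_p: "AE z in \<nu>. p (T z) \<noteq> 0"
  proof -
    have "AE z in \<nu>. \<forall>t\<in>range T. p t = 0 \<longrightarrow> T z \<noteq> t"
    proof (rule AE_finite_allI[OF finite_T])
      fix t
      have "{z. T z = t} \<in> sets \<nu>"
        using measurable_sets[OF T_cs, of "{t}"] by (simp add: vimage_def sets_\<nu>)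
      then have "p t = 0 \<Longrightarrow> {z. T z = t} \<in> null_sets \<nu>"
        using p_\<nu>[of t] by auto
      then show "AE z in \<nu>. p t = 0 \<longrightarrow> T z \<noteq> t"
        using AE_not_in by (cases "p t = 0") fastforce+
    qed
    then show ?thesis by eventually_elim auto
  qed
  have AE_p': "AE q in \<zeta>. p (T (fst q)) \<noteq> 0"
    using AE_p unfolding \<nu>_def by (subst (asm) AE_distr_iff) auto

  \<comment> \<open>The kernel \<open>K z\<close> integrates against the density \<open>\<rho> z\<close>, which is symmetric in its two arguments.\<close>
  define \<rho> where "\<rho> z z' = indicator {z'. T z' = T z} z' / p (T z)" for z z'
  have \<rho>_measurable[measurable]: "(\<lambda>(z, z'). \<rho> z z') \<in> borel_measurable (borel \<Otimes>\<^sub>M borel)"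
    unfolding \<rho>_def by (simp add: indicator_def)
  have \<rho>_sum: "(\<integral>\<^sup>+z. \<rho> z z' \<partial>\<nu>) = 1" if "p (T z') \<noteq> 0" for z'
  proof -
    have "(\<integral>\<^sup>+z. \<rho> z z' \<partial>\<nu>) = (\<integral>\<^sup>+z. indicator {z. T z = T z'} z / p (T z') \<partial>\<nu>)"
      by (rule nn_integral_cong) (auto simp: \<rho>_def indicator_def)
    also have "\<dots> = p (T z') / p (T z')"
      by (subst nn_integral_divide) (auto simp: p_\<nu> intro!: arg_cong2[of _ _ _ _ "(/)"] nn_integral_indicator)
    finally show ?thesis
      using that p_finite[of "T z'"] by (simp add: ennreal_divide_self less_top)
  qed
  have \<rho>_sum': "(\<integral>\<^sup>+q. \<rho> z (fst q) \<partial>\<zeta>) = 1" if "p (T z) \<noteq> 0" for z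
  proof -
    have "(\<integral>\<^sup>+q. \<rho> z (fst q) \<partial>\<zeta>) = (\<integral>\<^sup>+q. indicator (A (T z)) q / p (T z) \<partial>\<zeta>)"
      by (rule nn_integral_cong) (auto simp: \<rho>_def A_def indicator_def)
    also have "\<dots> = p (T z) / p (T z)"
      by (subst nn_integral_divide) (auto simp: p_def)
    finally show ?thesis
      using that p_finite[of "T z"] by (simp add: ennreal_divide_self less_top)
  qed
  \<comment> \<open>Averaging the conditional laws of the coupling over the cells gives back the coupling.\<close>
  have swap: "(\<integral>\<^sup>+z. \<integral>\<^sup>+q. h q * \<rho> z (fst q) \<partial>\<zeta> \<partial>\<nu>) = (\<integral>\<^sup>+q. h q \<partial>\<zeta>)"
    if [measurable]: "h \<in> borel_measurable borel" for h :: "'a \<times> 'a \<Rightarrow> ennreal"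
  proof -
    have "(\<integral>\<^sup>+z. \<integral>\<^sup>+q. h q * \<rho> z (fst q) \<partial>\<zeta> \<partial>\<nu>) = (\<integral>\<^sup>+q. \<integral>\<^sup>+z. h q * \<rho> z (fst q) \<partial>\<nu> \<partial>\<zeta>)"
      by (rule \<nu>\<zeta>.Fubini'[symmetric]) measurable
    also have "\<dots> = (\<integral>\<^sup>+q. h q * (\<integral>\<^sup>+z. \<rho> z (fst q) \<partial>\<nu>) \<partial>\<zeta>)"
      by (intro nn_integral_cong nn_integral_cmult) measurable
    also have "\<dots> = (\<integral>\<^sup>+q. h q \<partial>\<zeta>)"
      by (rule nn_integral_cong_AE) (use AE_p' in eventually_elim, simp add: \<rho>_sum)
    finally show ?thesis .
  qed

  \<comment> \<open>On a null cell any probability measure will do.\<close>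
  define K' where "K' t = (if p t = 0 then distr \<zeta> borel snd else distr (uniform_measure \<zeta> (A t)) borel snd)" for t
  define K where "K z = K' (T z)" for z
  have K: "K \<in> borel \<rightarrow>\<^sub>M prob_algebra borel"
    unfolding K_def
  proof (rule measurable_compose[OF T_cs])
    have "K' t \<in> space (prob_algebra borel)" for t
      unfolding K'_def p_def space_prob_algebra using p_finite[of t]
      by (auto simp: p_def intro!: \<zeta>.prob_space_distr prob_space.prob_space_distr prob_space_uniform_measure)
    then show "K' \<in> count_space UNIV \<rightarrow>\<^sub>M prob_algebra borel"
      by auto
  qed
  have K_integral: "(\<integral>\<^sup>+w. g w \<partial>K z) = (\<integral>\<^sup>+q. g (snd q) * \<rho> z (fst q) \<partial>\<zeta>)"
    if "p (T z) \<noteq> 0" and [measurable]: "g \<in> borel_measurable borel" for g :: "'a \<Rightarrow> ennreal" and z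
  proof -
    have "(\<integral>\<^sup>+w. g w \<partial>K z) = (\<integral>\<^sup>+q. g (snd q) \<partial>uniform_measure \<zeta> (A (T z)))"
      using that by (simp add: K_def K'_def nn_integral_distr)
    also have "\<dots> = (\<integral>\<^sup>+q. g (snd q) * indicator (A (T z)) q \<partial>\<zeta>) / p (T z)"
      unfolding p_def by (rule nn_integral_uniform_measure) measurable
    also have "\<dots> = (\<integral>\<^sup>+q. g (snd q) * indicator (A (T z)) q / p (T z) \<partial>\<zeta>)"
      by (rule nn_integral_divide[symmetric]) measurable
    also have "\<dots> = (\<integral>\<^sup>+q. g (snd q) * \<rho> z (fst q) \<partial>\<zeta>)"
      by (rule nn_integral_cong) (auto simp: \<rho>_def A_def indicator_def ennreal_times_divide)
    finally show ?thesis .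
  qed

  have "\<nu> \<bind> K = distr \<zeta> borel snd"
  proof (rule measure_eqI)
    have K_sub: "K \<in> \<nu> \<rightarrow>\<^sub>M subprob_algebra borel"
      using measurable_prob_algebraD[OF K] by (simp add: measurable_cong_sets[OF sets_\<nu> refl])
    show sets_eq: "sets (\<nu> \<bind> K) = sets (distr \<zeta> borel snd)"
      using sets_bind[OF sets_kernel[OF K_sub] \<nu>.not_empty] by simp
    fix B assume "B \<in> sets (\<nu> \<bind> K)"
    then have [measurable]: "B \<in> sets borel"
      using sets_eq by simp
    have "emeasure (\<nu> \<bind> K) B = (\<integral>\<^sup>+z. emeasure (K z) B \<partial>\<nu>)"
      by (rule emeasure_bind[OF \<nu>.not_empty K_sub]) simp
    also have "\<dots> = (\<integral>\<^sup>+z. \<integral>\<^sup>+q. indicator B (snd q) * \<rho> z (fst q) \<partial>\<zeta> \<partial>\<nu>)"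
    proof (rule nn_integral_cong_AE, use AE_p in eventually_elim)
      case (elim z)
      have "emeasure (K z) B = (\<integral>\<^sup>+w. indicator B w \<partial>K z)"
        by (rule nn_integral_indicator[symmetric]) (simp add: K_def K'_def)
      then show ?case
        by (simp add: K_integral[OF elim])
    qed
    also have "\<dots> = (\<integral>\<^sup>+q. indicator B (snd q) \<partial>\<zeta>)"
      by (rule swap) measurable
    also have "\<dots> = emeasure (distr \<zeta> borel snd) B"
      by (subst nn_integral_distr[symmetric, of snd \<zeta> borel]) auto
    finally show "emeasure (\<nu> \<bind> K) B = emeasure (distr \<zeta> borel snd) B" .
  qed
  moreover have "(\<integral>\<^sup>+z. \<integral>\<^sup>+w. dist z w \<partial>K z \<partial>\<nu>) \<le> (\<integral>\<^sup>+q. dist (fst q) (snd q) \<partial>\<zeta>) + ennreal \<epsilon>"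
  proof -
    define h where "h q = ennreal (dist (T (fst q)) (fst q)) + ennreal (dist (fst q) (snd q))" for q
    have [measurable]: "h \<in> borel_measurable borel"
      unfolding h_def by measurable
    have "(\<integral>\<^sup>+z. \<integral>\<^sup>+w. dist z w \<partial>K z \<partial>\<nu>)
        \<le> (\<integral>\<^sup>+z. ennreal (dist (T z) z) + (\<integral>\<^sup>+q. h q * \<rho> z (fst q) \<partial>\<zeta>) \<partial>\<nu>)"
    proof (rule nn_integral_mono_AE, use AE_p in eventually_elim)
      case (elim z)
      have "(\<integral>\<^sup>+w. dist z w \<partial>K z) = (\<integral>\<^sup>+q. ennreal (dist z (snd q)) * \<rho> z (fst q) \<partial>\<zeta>)"
        by (rule K_integral[OF elim]) measurable
      also have "\<dots> \<le> (\<integral>\<^sup>+q. ennreal (dist (T z) z) * \<rho> z (fst q) + h q * \<rho> z (fst q) \<partial>\<zeta>)"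
      proof (rule nn_integral_mono)
        fix q
        have "ennreal (dist z (snd q)) \<le> ennreal (dist (T z) z) + h q" if "T (fst q) = T z"
        proof -
          have "dist z (snd q) \<le> dist (T z) z + (dist (T (fst q)) (fst q) + dist (fst q) (snd q))"
            using that dist_triangle[of z "snd q" "T z"] dist_triangle[of "T z" "snd q" "fst q"]
            by (simp add: dist_commute)
          then show ?thesis
            by (simp add: h_def ennreal_leI flip: ennreal_plus)
        qed
        then show "ennreal (dist z (snd q)) * \<rho> z (fst q)
            \<le> ennreal (dist (T z) z) * \<rho> z (fst q) + h q * \<rho> z (fst q)"
          by (cases "T (fst q) = T z")
            (auto simp: \<rho>_def simp flip: distrib_right intro!: mult_right_mono)
      qed
      also have "\<dots> = ennreal (dist (T z) z) * (\<integral>\<^sup>+q. \<rho> z (fst q) \<partial>\<zeta>) + (\<integral>\<^sup>+q. h q * \<rho> z (fst q) \<partial>\<zeta>)"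
        by (simp add: nn_integral_add nn_integral_cmult)
      finally show ?case
        by (simp add: \<rho>_sum'[OF elim])
    qed
    also have "\<dots> = (\<integral>\<^sup>+z. ennreal (dist (T z) z) \<partial>\<nu>) + (\<integral>\<^sup>+q. h q \<partial>\<zeta>)"
      by (subst nn_integral_add) (auto simp: swap)
    also have "(\<integral>\<^sup>+q. h q \<partial>\<zeta>) = (\<integral>\<^sup>+z. ennreal (dist (T z) z) \<partial>\<nu>) + (\<integral>\<^sup>+q. dist (fst q) (snd q) \<partial>\<zeta>)"
      unfolding h_def \<nu>_def by (subst nn_integral_add) (auto simp: nn_integral_distr)
    also have "(\<integral>\<^sup>+z. ennreal (dist (T z) z) \<partial>\<nu>) + ((\<integral>\<^sup>+z. ennreal (dist (T z) z) \<partial>\<nu>) + (\<integral>\<^sup>+q. dist (fst q) (snd q) \<partial>\<zeta>))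
        \<le> ennreal (\<epsilon> / 2) + (ennreal (\<epsilon> / 2) + (\<integral>\<^sup>+q. dist (fst q) (snd q) \<partial>\<zeta>))"
      using T_close by (intro add_mono order_refl) (auto simp: less_imp_le)
    also have "\<dots> = (\<integral>\<^sup>+q. dist (fst q) (snd q) \<partial>\<zeta>) + ennreal \<epsilon>"
      using \<open>\<epsilon> > 0\<close> by (simp add: add.assoc[symmetric] add.commute flip: ennreal_plus)
    finally show ?thesis .
  qed
  ultimately show ?thesis
    using that[OF K] by (simp add: \<nu>_def)
qed

text \<open>
  The form in which couplings are composed below: \<open>\<nu>2\<close> arises from \<open>\<nu>1\<close> by a random displacement
  whose mean length is almost the Wasserstein distance.
\<close>

lemma transport_kernel:
  fixes \<nu>1 \<nu>2 :: "'a :: compact_metric_space measure"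
  assumes "\<nu>1 \<in> borel_prob_measures" "\<nu>2 \<in> borel_prob_measures" "wasserstein \<nu>1 \<nu>2 < c"
  obtains K where "K \<in> borel \<rightarrow>\<^sub>M prob_algebra borel" and "\<nu>1 \<bind> K = \<nu>2"
    and "(\<integral>\<^sup>+z. \<integral>\<^sup>+w. dist z w \<partial>K z \<partial>\<nu>1) \<le> ennreal c"
proof -
  obtain \<zeta> where \<zeta>: "\<zeta> \<in> couplings \<nu>1 \<nu>2" "(\<integral>(x, y). dist x y \<partial>\<zeta>) < c"
    using near_optimal_coupling[OF assms] by metis
  define e where "e = c - (\<integral>(x, y). dist x y \<partial>\<zeta>)"
  have "e > 0" using \<zeta> by (simp add: e_def)
  have "ennreal (\<integral>(x, y). dist x y \<partial>\<zeta>) + ennreal e = ennreal c"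
    using \<open>e > 0\<close> cost_nonneg[of \<zeta>] by (subst ennreal_plus[symmetric]) (auto simp: e_def)
  with approximate_disintegration[OF couplingsD(1)[OF \<zeta>(1)] \<open>e > 0\<close>] couplingsD[OF \<zeta>(1)] that
  show ?thesis
    by (metis nn_integral_dist_coupling)
qed

text \<open>
  Draw a pair from a near-optimal coupling of \<open>\<nu>1\<close> and \<open>\<nu>2\<close> and displace its second point by a
  transport kernel from \<open>\<nu>2\<close> to \<open>\<nu>3\<close>. The first point and the displaced one form a coupling of
  \<open>\<nu>1\<close> and \<open>\<nu>3\<close>, and the pointwise triangle inequality bounds its cost.
\<close>

lemma wasserstein_triangle:
  fixes \<nu>1 \<nu>2 \<nu>3 :: "'a :: compact_metric_space measure"
  assumes \<nu>: "\<nu>1 \<in> borel_prob_measures" "\<nu>2 \<in> borel_prob_measures" "\<nu>3 \<in> borel_prob_measures"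
  shows "wasserstein \<nu>1 \<nu>3 \<le> wasserstein \<nu>1 \<nu>2 + wasserstein \<nu>2 \<nu>3"
proof (rule field_le_epsilon)
  fix e :: real assume "e > 0"
  define c1 where "c1 = wasserstein \<nu>1 \<nu>2 + e / 2"
  define c2 where "c2 = wasserstein \<nu>2 \<nu>3 + e / 2"
  have c12: "wasserstein \<nu>1 \<nu>2 < c1" "wasserstein \<nu>2 \<nu>3 < c2"
    using \<open>e > 0\<close> by (auto simp: c1_def c2_def)
  have pos: "0 \<le> c1" "0 \<le> c2"
    using c12 wasserstein_nonneg[OF \<nu>(1,2)] wasserstein_nonneg[OF \<nu>(2,3)] by auto
  obtain \<zeta> where \<zeta>: "\<zeta> \<in> couplings \<nu>1 \<nu>2" and cost_\<zeta>: "(\<integral>(x, y). dist x y \<partial>\<zeta>) < c1"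
    using near_optimal_coupling[OF \<nu>(1,2) c12(1)] by metis
  obtain K where K: "K \<in> borel \<rightarrow>\<^sub>M prob_algebra borel" "\<nu>2 \<bind> K = \<nu>3"
    and cost_K: "(\<integral>\<^sup>+z. \<integral>\<^sup>+w. dist z w \<partial>K z \<partial>\<nu>2) \<le> ennreal c2"
    using transport_kernel[OF \<nu>(2,3) c12(2)] by metis
  note sets_\<zeta>[measurable_cong] = couplingsD(1)[OF \<zeta>, THEN borel_prob_measuresD(2)]
  interpret \<zeta>: prob_space \<zeta> by (rule borel_prob_measuresD(1)[OF couplingsD(1)[OF \<zeta>]])
  have K_sub[measurable]: "K \<in> borel \<rightarrow>\<^sub>M subprob_algebra borel"
    using K(1) by (rule measurable_prob_algebraD)
  have K_prob: "prob_space (K z)" and sets_K[measurable_cong]: "sets (K z) = sets borel" for z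
    using measurable_space[OF K(1), of z] by (auto simp: space_prob_algebra)
  have [measurable]: "(\<lambda>z. \<integral>\<^sup>+w. dist z w \<partial>K z) \<in> borel_measurable borel"
    by (rule nn_integral_measurable_subprob_algebra2[OF _ K_sub]) measurable
  define J where "J q = distr (K (snd q)) borel (\<lambda>w. (fst q, w))" for q :: "'a \<times> 'a"
  have J[measurable]: "J \<in> \<zeta> \<rightarrow>\<^sub>M subprob_algebra borel"
    unfolding J_def by (rule measurable_distr2[where M=borel]) measurable
  have J_prob: "prob_space (J q)" for q
    unfolding J_def by (rule prob_space.prob_space_distr[OF K_prob]) measurable
  define G where "G = \<zeta> \<bind> J"
  have sets_G: "sets G = sets borel"
    unfolding G_def using sets_bind[OF sets_kernel[OF J] \<zeta>.not_empty] by simp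
  have "prob_space G"
    unfolding G_def by (rule \<zeta>.prob_space_bind[OF _ J]) (simp add: J_prob)
  moreover have "distr G borel fst = \<nu>1"
  proof -
    have "distr (J q) borel fst = return borel (fst q)" for q
      by (simp add: J_def distr_distr comp_def prob_space.distr_const[OF K_prob])
    then have "distr G borel fst = \<zeta> \<bind> (\<lambda>q. return borel (fst q))"
      unfolding G_def by (subst distr_bind[OF J \<zeta>.not_empty]) auto
    also have "\<dots> = \<nu>1"
      using couplingsD(2)[OF \<zeta>] by (subst bind_return_distr'[OF \<zeta>.not_empty]) auto
    finally show ?thesis .
  qed
  moreover have "distr G borel snd = \<nu>3"
  proof -
    have "distr (J q) borel snd = K (snd q)" for q
      by (simp add: J_def distr_distr comp_def distr_id2 sets_K)
    then have "distr G borel snd = \<zeta> \<bind> (\<lambda>q. K (snd q))"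
      unfolding G_def by (subst distr_bind[OF J \<zeta>.not_empty]) auto
    also have "\<dots> = distr \<zeta> borel snd \<bind> K"
      by (rule bind_distr[symmetric, OF _ _ \<zeta>.not_empty]) measurable
    finally show ?thesis
      using couplingsD(3)[OF \<zeta>] K(2) by simp
  qed
  ultimately have G: "G \<in> couplings \<nu>1 \<nu>3"
    using sets_G by (auto simp: couplings_def borel_prob_measures_def)
  have "ennreal (\<integral>(x, y). dist x y \<partial>G) = (\<integral>\<^sup>+q. dist (fst q) (snd q) \<partial>G)"
    using nn_integral_dist_coupling[OF couplingsD(1)[OF G]] by simp
  also have "\<dots> = (\<integral>\<^sup>+q. \<integral>\<^sup>+w. dist (fst q) w \<partial>K (snd q) \<partial>\<zeta>)"
    unfolding G_def
    by (subst nn_integral_bind[OF _ J]) (auto simp: J_def nn_integral_distr intro!: nn_integral_cong)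
  also have "\<dots> \<le> (\<integral>\<^sup>+q. ennreal (dist (fst q) (snd q)) + (\<integral>\<^sup>+w. dist (snd q) w \<partial>K (snd q)) \<partial>\<zeta>)"
  proof (rule nn_integral_mono)
    fix q :: "'a \<times> 'a"
    have "(\<integral>\<^sup>+w. dist (fst q) w \<partial>K (snd q)) \<le> (\<integral>\<^sup>+w. ennreal (dist (fst q) (snd q)) + ennreal (dist (snd q) w) \<partial>K (snd q))"
      by (intro nn_integral_mono) (auto intro!: ennreal_leI dist_triangle simp flip: ennreal_plus)
    also have "\<dots> = ennreal (dist (fst q) (snd q)) + (\<integral>\<^sup>+w. dist (snd q) w \<partial>K (snd q))"
      by (subst nn_integral_add) (auto simp: prob_space.emeasure_space_1[OF K_prob])
    finally show "(\<integral>\<^sup>+w. dist (fst q) w \<partial>K (snd q)) \<le> ennreal (dist (fst q) (snd q)) + (\<integral>\<^sup>+w. dist (snd q) w \<partial>K (snd q))" .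
  qed
  also have "\<dots> = (\<integral>\<^sup>+q. dist (fst q) (snd q) \<partial>\<zeta>) + (\<integral>\<^sup>+z. \<integral>\<^sup>+w. dist z w \<partial>K z \<partial>distr \<zeta> borel snd)"
    by (subst nn_integral_add) (auto simp: nn_integral_distr)
  also have "\<dots> \<le> ennreal c1 + ennreal c2"
    using cost_\<zeta> cost_K nn_integral_dist_coupling[OF couplingsD(1)[OF \<zeta>]] couplingsD(3)[OF \<zeta>]
    by (intro add_mono) (auto intro!: ennreal_leI)
  also have "\<dots> = ennreal (c1 + c2)"
    using pos by simp
  finally have "(\<integral>(x, y). dist x y \<partial>G) \<le> c1 + c2"
    using pos by (subst (asm) ennreal_le_iff) auto
  with wasserstein_le_coupling[OF G] show "wasserstein \<nu>1 \<nu>3 \<le> wasserstein \<nu>1 \<nu>2 + wasserstein \<nu>2 \<nu>3 + e"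
    by (simp add: c1_def c2_def)
qed

section \<open>Completeness of the Wasserstein distance\<close>

text \<open>
  The Ionescu-Tulcea theorem for kernels that depend on the last state only. The process is described
  by its initial law and by the integrals over two consecutive states, which determine the law
  of every state.
\<close>

lemma markov_chain_exists:
  fixes \<nu> :: "'a :: topological_space measure"
  assumes \<nu>: "\<nu> \<in> space (prob_algebra borel)" and K: "\<And>i :: nat. K i \<in> borel \<rightarrow>\<^sub>M prob_algebra borel"
  obtains L :: "(nat \<Rightarrow> 'a) measure"
  where "prob_space L" and "sets L = sets (PiM UNIV (\<lambda>_. borel))" and "distr L borel (\<lambda>\<omega>. \<omega> 0) = \<nu>"
    and "\<And>i f. (\<lambda>(z, w). f z w) \<in> borel_measurable (borel \<Otimes>\<^sub>M borel) \<Longrightarrow>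
      (\<integral>\<^sup>+\<omega>. f (\<omega> i) (\<omega> (Suc i)) \<partial>L) = (\<integral>\<^sup>+\<omega>. \<integral>\<^sup>+w. f (\<omega> i) w \<partial>K i (\<omega> i) \<partial>L)"
proof -
  define P :: "nat \<Rightarrow> (nat \<Rightarrow> 'a) \<Rightarrow> 'a measure"
    where "P i \<omega> = (case i of 0 \<Rightarrow> \<nu> | Suc j \<Rightarrow> K j (\<omega> j))" for i \<omega>
  have K_sub[measurable]: "K i \<in> borel \<rightarrow>\<^sub>M subprob_algebra borel" for i
    using K by (rule measurable_prob_algebraD)
  have P_prob: "P i \<in> PiM {0..<i} (\<lambda>_. borel) \<rightarrow>\<^sub>M prob_algebra borel" for i
  proof (cases i)
    case 0
    then have "P i = (\<lambda>_. \<nu>)" by (simp add: P_def fun_eq_iff)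
    then show ?thesis using \<nu> by simp
  next
    case (Suc j)
    have "(\<lambda>\<omega>. K j (\<omega> j)) \<in> PiM {0..<i} (\<lambda>_. borel) \<rightarrow>\<^sub>M prob_algebra borel"
      by (rule measurable_compose[OF _ K]) (rule measurable_component_singleton, simp add: Suc)
    then show ?thesis using Suc by (simp add: P_def[abs_def])
  qed
  have P_space: "prob_space (P i x)" if "x \<in> space (PiM {0..<i} (\<lambda>_. borel))" for i x
    using measurable_space[OF P_prob that] by (simp add: space_prob_algebra)
  interpret Ionescu_Tulcea P "\<lambda>_. borel"
    by (rule Ionescu_Tulcea.intro[OF measurable_prob_algebraD[OF P_prob] P_space])
  define u where "u = (\<lambda>_ :: nat. undefined :: 'a)"
  have u: "u \<in> space (PiM {0..<0} (\<lambda>_. borel))"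
    by (simp add: u_def space_PiM)
  have sets_L[measurable_cong]: "sets PF.lim = sets (PiM UNIV (\<lambda>_. borel))"
    by (rule PF.sets_lim)
  have lim_C: "(\<integral>\<^sup>+\<omega>. F (restrict \<omega> {0..<n}) \<partial>PF.lim) = (\<integral>\<^sup>+x. F x \<partial>C 0 n u)"
    if [measurable]: "F \<in> borel_measurable (PiM {0..<n} (\<lambda>_. borel))" for F :: "(nat \<Rightarrow> 'a) \<Rightarrow> ennreal" and n
  proof -
    have "n \<le> up_to {0..<n}"
      using up_to[of "{0..<n}"] by (cases n) auto
    then have "n = up_to {0..<n}"
      using up_to_iff_Ico[of "{0..<n}" n] by auto
    then have "CI {0..<n} = distr (C 0 n u) (PiM {0..<n} (\<lambda>_. borel)) (\<lambda>x. restrict x {0..<n})"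
      by (simp add: CI_def u_def)
    also have "\<dots> = C 0 n u"
      using distr_C[of n n u 0] u by simp
    finally have "C 0 n u = distr PF.lim (PiM {0..<n} (\<lambda>_. borel)) (\<lambda>x. restrict x {0..<n})"
      using distr_lim[of "{0..<n}"] by simp
    then show ?thesis
      by (simp add: nn_integral_distr)
  qed
  \<comment> \<open>The law of the first \<open>n + 1\<close> states arises from that of the first \<open>n\<close> by one application of a kernel.\<close>
  have step: "(\<integral>\<^sup>+\<omega>. F (restrict \<omega> {0..<Suc n}) \<partial>PF.lim)
      = (\<integral>\<^sup>+x. \<integral>\<^sup>+w. F (x(n := w)) \<partial>P n x \<partial>C 0 n u)"
    if [measurable]: "F \<in> borel_measurable (PiM {0..<Suc n} (\<lambda>_. borel))" for F :: "(nat \<Rightarrow> 'a) \<Rightarrow> ennreal" and n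
  proof -
    have "(\<integral>\<^sup>+\<omega>. F (restrict \<omega> {0..<Suc n}) \<partial>PF.lim) = (\<integral>\<^sup>+x. F x \<partial>(C 0 n u \<bind> eP n))"
      by (subst lim_C) auto
    also have "\<dots> = (\<integral>\<^sup>+x. \<integral>\<^sup>+y. F y \<partial>eP n x \<partial>C 0 n u)"
      using measurable_eP[of n] sets_C[OF u, of n]
      by (intro nn_integral_bind[where B="PiM {0..<Suc n} (\<lambda>_. borel)"]) (auto cong: measurable_cong_sets)
    also have "\<dots> = (\<integral>\<^sup>+x. \<integral>\<^sup>+w. F (x(n := w)) \<partial>P n x \<partial>C 0 n u)"
      using space_C[OF u, of n] by (intro nn_integral_cong nn_integral_eP) auto
    finally show ?thesis .
  qed
  have "prob_space PF.lim"
  proof (rule prob_space_distrD)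
    show "(\<lambda>x. restrict x {}) \<in> PF.lim \<rightarrow>\<^sub>M PiM {} (\<lambda>_. borel)"
      by measurable
    show "prob_space (distr PF.lim (PiM {} (\<lambda>_. borel)) (\<lambda>x. restrict x {}))"
      using PF.prob_space_P[of "{}"] by (subst distr_lim) auto
  qed
  then show ?thesis
  proof (rule that[OF _ sets_L])
    show "distr PF.lim borel (\<lambda>\<omega>. \<omega> 0) = \<nu>"
    proof (rule measure_eqI)
      fix B assume "B \<in> sets (distr PF.lim borel (\<lambda>\<omega>. \<omega> 0))"
      then have [measurable]: "B \<in> sets borel" by simp
      have "emeasure (distr PF.lim borel (\<lambda>\<omega>. \<omega> 0)) B = (\<integral>\<^sup>+z. indicator B z \<partial>distr PF.lim borel (\<lambda>\<omega>. \<omega> 0))"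
        by simp
      also have "\<dots> = (\<integral>\<^sup>+\<omega>. indicator B (\<omega> 0) \<partial>PF.lim)"
        by (rule nn_integral_distr) measurable
      also have "\<dots> = (\<integral>\<^sup>+x. \<integral>\<^sup>+w. indicator B w \<partial>P 0 x \<partial>C 0 0 u)"
        using step[of "\<lambda>\<omega>. indicator B (\<omega> 0)" 0] by simp
      also have "\<dots> = emeasure \<nu> B"
        using u \<nu> by (simp add: P_def nn_integral_return space_prob_algebra)
      finally show "emeasure (distr PF.lim borel (\<lambda>\<omega>. \<omega> 0)) B = emeasure \<nu> B" .
    qed (use \<nu> in \<open>simp add: space_prob_algebra\<close>)
    fix i and f :: "'a \<Rightarrow> 'a \<Rightarrow> ennreal"
    assume f[measurable]: "(\<lambda>(z, w). f z w) \<in> borel_measurable (borel \<Otimes>\<^sub>M borel)"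
    have K_f[measurable]: "(\<lambda>z. \<integral>\<^sup>+w. f z w \<partial>K i z) \<in> borel_measurable borel"
      by (rule nn_integral_measurable_subprob_algebra2[OF f K_sub])
    have "(\<lambda>x. f (x i) (x (Suc i))) \<in> borel_measurable (PiM {0..<Suc (Suc i)} (\<lambda>_. borel))"
      by measurable
    from step[OF this] have "(\<integral>\<^sup>+\<omega>. f (\<omega> i) (\<omega> (Suc i)) \<partial>PF.lim)
        = (\<integral>\<^sup>+x. \<integral>\<^sup>+w. f (x i) w \<partial>K i (x i) \<partial>C 0 (Suc i) u)"
      by (simp add: P_def)
    also have "\<dots> = (\<integral>\<^sup>+\<omega>. \<integral>\<^sup>+w. f (\<omega> i) w \<partial>K i (\<omega> i) \<partial>PF.lim)"
      using lim_C[of "\<lambda>x. \<integral>\<^sup>+w. f (x i) w \<partial>K i (x i)" "Suc i"] by simp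
    finally show "(\<integral>\<^sup>+\<omega>. f (\<omega> i) (\<omega> (Suc i)) \<partial>PF.lim) = (\<integral>\<^sup>+\<omega>. \<integral>\<^sup>+w. f (\<omega> i) w \<partial>K i (\<omega> i) \<partial>PF.lim)" .
  qed
qed

lemma Cauchy_if_summable_dist:
  fixes x :: "nat \<Rightarrow> 'a :: metric_space"
  assumes "summable (\<lambda>i. dist (x i) (x (Suc i)))"
  shows "Cauchy x"
proof (rule CauchyI')
  fix e :: real assume "e > 0"
  have tail: "dist (x m) (x n) \<le> (\<Sum>i=m..<n. dist (x i) (x (Suc i)))" if "m \<le> n" for m n
    using that
  proof (induction n rule: dec_induct)
    case (step n)
    then show ?case
      using dist_triangle[of "x m" "x (Suc n)" "x n"] by simp
  qed simp
  from assms \<open>e > 0\<close> obtain M where "\<And>m n. m \<ge> M \<Longrightarrow> norm (\<Sum>i=m..<n. dist (x i) (x (Suc i))) < e"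
    unfolding summable_Cauchy by blast
  then show "\<exists>M. \<forall>m\<ge>M. \<forall>n>m. dist (x m) (x n) < e"
    using tail by (smt (verit) less_imp_le_nat real_norm_def)
qed

text \<open>
  Let \<open>\<omega> 0, \<omega> 1, ...\<close> be the Markov chain with initial law \<open>\<nu> 0\<close> that moves by transport kernels from
  \<open>\<nu> i\<close> to \<open>\<nu> (Suc i)\<close>. Its state \<open>\<omega> i\<close> has law \<open>\<nu> i\<close>, and the expected total length of its path is
  finite. Hence almost every path converges, and the joint law of \<open>\<omega> i\<close> and the limit point couples
  \<open>\<nu> i\<close> with the law of the limit point at a cost that tends to 0.
\<close>

lemma wasserstein_convergent_if_fast_Cauchy:
  fixes \<nu> :: "nat \<Rightarrow> 'a :: compact_metric_space measure"
  assumes \<nu>: "\<And>i. \<nu> i \<in> borel_prob_measures"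
    and fast: "\<And>i. wasserstein (\<nu> i) (\<nu> (Suc i)) < (1 / 2) ^ i"
  shows "\<exists>\<nu>'\<in>borel_prob_measures. (\<lambda>i. wasserstein (\<nu> i) \<nu>') \<longlonglongrightarrow> 0"
proof -
  have "\<exists>K. K \<in> borel \<rightarrow>\<^sub>M prob_algebra borel \<and> \<nu> i \<bind> K = \<nu> (Suc i) \<and>
      (\<integral>\<^sup>+z. \<integral>\<^sup>+w. dist z w \<partial>K z \<partial>\<nu> i) \<le> ennreal ((1 / 2) ^ i)" for i
    using transport_kernel[OF \<nu> \<nu> fast] by metis
  then obtain K where K: "\<And>i. K i \<in> borel \<rightarrow>\<^sub>M prob_algebra borel"
    and bind_K: "\<And>i. \<nu> i \<bind> K i = \<nu> (Suc i)"
    and cost_K: "\<And>i. (\<integral>\<^sup>+z. \<integral>\<^sup>+w. dist z w \<partial>K i z \<partial>\<nu> i) \<le> ennreal ((1 / 2) ^ i)"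
    by metis
  have K_sub[measurable]: "K i \<in> borel \<rightarrow>\<^sub>M subprob_algebra borel" for i
    using K by (rule measurable_prob_algebraD)
  have \<nu>_0: "\<nu> 0 \<in> space (prob_algebra borel)"
    using \<nu>[of 0] by (simp add: space_prob_algebra borel_prob_measures_def)
  obtain L :: "(nat \<Rightarrow> 'a) measure" where L: "prob_space L"
    and sets_L[measurable_cong]: "sets L = sets (PiM UNIV (\<lambda>_. borel))"
    and law_0: "distr L borel (\<lambda>\<omega>. \<omega> 0) = \<nu> 0"
    and step: "\<And>i f. (\<lambda>(z, w). f z w) \<in> borel_measurable (borel \<Otimes>\<^sub>M borel) \<Longrightarrow>
      (\<integral>\<^sup>+\<omega>. f (\<omega> i) (\<omega> (Suc i)) \<partial>L) = (\<integral>\<^sup>+\<omega>. \<integral>\<^sup>+w. f (\<omega> i) w \<partial>K i (\<omega> i) \<partial>L)"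
    by (rule markov_chain_exists[where K = K, OF \<nu>_0 K]) blast
  interpret L: prob_space L by fact
  have law: "distr L borel (\<lambda>\<omega>. \<omega> i) = \<nu> i" for i
  proof (induction i)
    case 0
    show ?case by (rule law_0)
  next
    case (Suc i)
    show ?case
    proof (rule measure_eqI)
      fix B assume "B \<in> sets (distr L borel (\<lambda>\<omega>. \<omega> (Suc i)))"
      then have [measurable]: "B \<in> sets borel" by simp
      have K_B: "(\<integral>\<^sup>+w. indicator B w \<partial>K i z) = emeasure (K i z) B" for z
        using measurable_space[OF K, of z i] by (intro nn_integral_indicator) (simp add: space_prob_algebra)
      have "emeasure (distr L borel (\<lambda>\<omega>. \<omega> (Suc i))) B = (\<integral>\<^sup>+z. indicator B z \<partial>distr L borel (\<lambda>\<omega>. \<omega> (Suc i)))"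
        by simp
      also have "\<dots> = (\<integral>\<^sup>+\<omega>. indicator B (\<omega> (Suc i)) \<partial>L)"
        by (rule nn_integral_distr) measurable
      also have "\<dots> = (\<integral>\<^sup>+\<omega>. emeasure (K i (\<omega> i)) B \<partial>L)"
        using step[of "\<lambda>z w. indicator B w" i] by (simp add: K_B)
      also have "\<dots> = (\<integral>\<^sup>+z. emeasure (K i z) B \<partial>distr L borel (\<lambda>\<omega>. \<omega> i))"
        by (rule nn_integral_distr[symmetric]) measurable
      also have "\<dots> = emeasure (\<nu> i \<bind> K i) B"
        unfolding Suc
        by (intro emeasure_bind[symmetric, where N=borel]) (auto simp: K_sub borel_prob_measuresD(3,4)[OF \<nu>])
      finally show "emeasure (distr L borel (\<lambda>\<omega>. \<omega> (Suc i))) B = emeasure (\<nu> (Suc i)) B"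
        by (simp add: bind_K)
    qed (use borel_prob_measuresD(2)[OF \<nu>] in simp)
  qed
  have cost: "(\<integral>\<^sup>+\<omega>. dist (\<omega> i) (\<omega> (Suc i)) \<partial>L) \<le> ennreal ((1 / 2) ^ i)" for i
  proof -
    have [measurable]: "(\<lambda>z. \<integral>\<^sup>+w. dist z w \<partial>K i z) \<in> borel_measurable borel"
      by (rule nn_integral_measurable_subprob_algebra2[OF _ K_sub]) measurable
    have "(\<integral>\<^sup>+\<omega>. dist (\<omega> i) (\<omega> (Suc i)) \<partial>L) = (\<integral>\<^sup>+\<omega>. \<integral>\<^sup>+w. dist (\<omega> i) w \<partial>K i (\<omega> i) \<partial>L)"
      by (rule step) measurable
    also have "\<dots> = (\<integral>\<^sup>+z. \<integral>\<^sup>+w. dist z w \<partial>K i z \<partial>\<nu> i)"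
      unfolding law[of i, symmetric] by (rule nn_integral_distr[symmetric]) measurable
    finally show ?thesis using cost_K by simp
  qed
  have AE_Cauchy: "AE \<omega> in L. Cauchy \<omega>"
  proof -
    have "(\<integral>\<^sup>+\<omega>. (\<Sum>i. ennreal (dist (\<omega> i) (\<omega> (Suc i)))) \<partial>L)
        = (\<Sum>i. \<integral>\<^sup>+\<omega>. ennreal (dist (\<omega> i) (\<omega> (Suc i))) \<partial>L)"
      by (rule nn_integral_suminf) measurable
    also have "\<dots> \<le> (\<Sum>i. ennreal ((1 / 2) ^ i))"
      using cost by (intro suminf_le) auto
    also have "\<dots> < \<infinity>"
      by (subst suminf_ennreal2) (auto intro: summable_geometric)
    finally have "AE \<omega> in L. (\<Sum>i. ennreal (dist (\<omega> i) (\<omega> (Suc i)))) \<noteq> \<infinity>"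
      by (intro nn_integral_noteq_infinite) auto
    then show ?thesis
    proof eventually_elim
      case (elim \<omega>)
      then show ?case
        by (intro Cauchy_if_summable_dist summable_suminf_not_top) auto
    qed
  qed
  \<comment> \<open>Divergent paths form a null set; a constant value on them keeps \<open>X\<close> measurable.\<close>
  define X where "X \<omega> = (if Cauchy \<omega> then lim \<omega> else undefined)" for \<omega> :: "nat \<Rightarrow> 'a"
  have X_lim: "\<omega> \<longlonglongrightarrow> X \<omega>" if "Cauchy \<omega>" for \<omega>
    using Cauchy_convergent[OF that] that by (simp add: X_def convergent_LIMSEQ_iff)
  have X[measurable]: "X \<in> borel_measurable L"
  proof (rule borel_measurable_LIMSEQ_metric)
    have [measurable]: "Measurable.pred L Cauchy"
      using sets_Collect_Cauchy[of "\<lambda>i \<omega>. \<omega> i" L] by (simp add: pred_def)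
    show "(\<lambda>\<omega>. if Cauchy \<omega> then \<omega> i else undefined) \<in> borel_measurable L" for i
      by measurable
    show "(\<lambda>i. if Cauchy \<omega> then \<omega> i else undefined) \<longlonglongrightarrow> X \<omega>" for \<omega>
      using X_lim[of \<omega>] by (auto simp: X_def)
  qed
  define \<nu>' where "\<nu>' = distr L borel X"
  have \<nu>': "\<nu>' \<in> borel_prob_measures"
    unfolding \<nu>'_def by (rule distr_in_borel_prob_measures[OF L X])
  have "(\<lambda>i. \<integral>\<omega>. dist (\<omega> i) (X \<omega>) \<partial>L) \<longlonglongrightarrow> (\<integral>\<omega>. 0 \<partial>L)"
  proof (rule integral_dominated_convergence[where w="\<lambda>_. diameter (UNIV :: 'a set)"])
    show "AE \<omega> in L. (\<lambda>i. dist (\<omega> i) (X \<omega>)) \<longlonglongrightarrow> 0"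
      using AE_Cauchy by eventually_elim (rule iffD1[OF tendsto_dist_iff X_lim])
  qed (auto simp: dist_le_diameter)
  then have lim_cost: "(\<lambda>i. \<integral>\<omega>. dist (\<omega> i) (X \<omega>) \<partial>L) \<longlonglongrightarrow> 0"
    by simp
  have upper: "wasserstein (\<nu> i) \<nu>' \<le> (\<integral>\<omega>. dist (\<omega> i) (X \<omega>) \<partial>L)" for i
    unfolding \<nu>'_def law[of i, symmetric] by (rule wasserstein_le_expectation[OF L]) measurable
  have "(\<lambda>i. wasserstein (\<nu> i) \<nu>') \<longlonglongrightarrow> 0"
    by (rule tendsto_sandwich[OF _ _ tendsto_const lim_cost])
      (simp_all add: upper wasserstein_nonneg[OF \<nu> \<nu>'])
  with \<nu>' show ?thesis by blast
qed

text \<open>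
  Far along the sequence all measures are close to each other, so it suffices that the measures at suitable
  times \<open>r i\<close> converge. These times are chosen so late that \<open>\<nu> (r i)\<close> is fast Cauchy.
\<close>

lemma wasserstein_complete:
  fixes \<nu> :: "nat \<Rightarrow> 'a :: compact_metric_space measure"
  assumes \<nu>: "\<And>i. \<nu> i \<in> borel_prob_measures"
    and Cauchy: "\<And>e. e > 0 \<Longrightarrow> \<exists>N. \<forall>m\<ge>N. \<forall>n\<ge>N. wasserstein (\<nu> m) (\<nu> n) < e"
  shows "\<exists>\<nu>'\<in>borel_prob_measures. (\<lambda>i. wasserstein (\<nu> i) \<nu>') \<longlonglongrightarrow> 0"
proof -
  have "\<exists>N. \<forall>m\<ge>N. \<forall>n\<ge>N. wasserstein (\<nu> m) (\<nu> n) < (1 / 2) ^ i" for i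
    by (rule Cauchy) simp
  then obtain N where N: "\<And>i m n. m \<ge> N i \<Longrightarrow> n \<ge> N i \<Longrightarrow> wasserstein (\<nu> m) (\<nu> n) < (1 / 2) ^ i"
    by metis
  \<comment> \<open>Partial sums make both \<open>r i\<close> and \<open>r (Suc i)\<close> at least \<open>N i\<close>.\<close>
  define r where "r i = (\<Sum>j\<le>i. N j)" for i
  have r: "N i \<le> r i" "N i \<le> r (Suc i)" for i
    unfolding r_def by (auto intro!: member_le_sum simp del: sum.atMost_Suc)
  have "\<exists>\<nu>'\<in>borel_prob_measures. (\<lambda>i. wasserstein (\<nu> (r i)) \<nu>') \<longlonglongrightarrow> 0"
    using N r by (intro wasserstein_convergent_if_fast_Cauchy \<nu>) auto
  then obtain \<nu>' where \<nu>': "\<nu>' \<in> borel_prob_measures" "(\<lambda>i. wasserstein (\<nu> (r i)) \<nu>') \<longlonglongrightarrow> 0"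
    by blast
  have "(\<lambda>i. wasserstein (\<nu> i) \<nu>') \<longlonglongrightarrow> 0"
  proof (rule LIMSEQ_I)
    fix e :: real assume "e > 0"
    then have "eventually (\<lambda>i. wasserstein (\<nu> (r i)) \<nu>' < e / 2) sequentially"
      using order_tendstoD(2)[OF \<nu>'(2), of "e / 2"] by simp
    moreover have "eventually (\<lambda>i. (1 / 2 :: real) ^ i < e / 2) sequentially"
      using order_tendstoD(2)[OF LIMSEQ_power_zero[of "1 / 2 :: real"], of "e / 2"] \<open>e > 0\<close> by simp
    ultimately have "eventually (\<lambda>i. wasserstein (\<nu> (r i)) \<nu>' < e / 2 \<and> (1 / 2 :: real) ^ i < e / 2) sequentially"
      by (rule eventually_conj)
    then obtain i where i: "wasserstein (\<nu> (r i)) \<nu>' < e / 2" "(1 / 2 :: real) ^ i < e / 2"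
      by (auto simp: eventually_sequentially)
    have "norm (wasserstein (\<nu> n) \<nu>' - 0) < e" if "n \<ge> N i" for n
      using wasserstein_triangle[OF \<nu> \<nu> \<nu>'(1), of n "r i"] N[OF that r(1)] i
        wasserstein_nonneg[OF \<nu> \<nu>'(1), of n] by simp
    then show "\<exists>n0. \<forall>n\<ge>n0. norm (wasserstein (\<nu> n) \<nu>' - 0) < e"
      by blast
  qed
  with \<nu>'(1) show ?thesis by blast
qed

section \<open>Distances between empirical measures\<close>

text \<open>
  Realising empirical measures as laws of the orbit at a uniform random time lets orbits be coupled
  by running them simultaneously.
\<close>

lemma empirical_measure_eq_distr:
  assumes "n \<ge> 1"
  shows "empirical_measure f n x = distr (measure_pmf (pmf_of_set {..<n})) borel (\<lambda>i. (f ^^ i) x)"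
proof (rule measure_eqI)
  fix A assume "A \<in> sets (empirical_measure f n x)"
  then have A: "A \<in> sets borel" by simp
  have "{..<n} \<noteq> {}" using assms by (simp add: lessThan_empty_iff)
  let ?p = "measure_pmf (pmf_of_set {..<n})"
  have "emeasure (distr ?p borel (\<lambda>i. (f ^^ i) x)) A = (\<integral>\<^sup>+y. indicator A y \<partial>distr ?p borel (\<lambda>i. (f ^^ i) x))"
    using A by simp
  also have "\<dots> = (\<integral>\<^sup>+i. indicator A ((f ^^ i) x) \<partial>?p)"
    using A by (intro nn_integral_distr) auto
  also have "\<dots> = (\<Sum>i<n. indicator A ((f ^^ i) x)) / of_nat n"
    using \<open>{..<n} \<noteq> {}\<close> by (simp add: nn_integral_pmf_of_set ennreal_of_nat_eq_real_of_nat)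
  also have "\<dots> = emeasure (empirical_measure f n x) A"
    using A by (simp add: emeasure_empirical_measure)
  finally show "emeasure (empirical_measure f n x) A
      = emeasure (distr ?p borel (\<lambda>i. (f ^^ i) x)) A" ..
qed simp

abbreviation empirical_dist ::
  "('a :: compact_metric_space \<Rightarrow> 'a) \<Rightarrow> ('a \<Rightarrow> 'a) \<Rightarrow> nat \<Rightarrow> nat \<Rightarrow> 'a \<Rightarrow> 'a \<Rightarrow> real" where
  "empirical_dist h g n m x y \<equiv> wasserstein (empirical_measure h n x) (empirical_measure g m y)"

lemma empirical_dist_nonneg: "n \<ge> 1 \<Longrightarrow> m \<ge> 1 \<Longrightarrow> 0 \<le> empirical_dist h g n m x y"
  by (intro wasserstein_nonneg empirical_measure_in_borel_prob_measures)

lemma empirical_dist_le_diameter: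
  fixes x y :: "'a :: compact_metric_space"
  shows "n \<ge> 1 \<Longrightarrow> m \<ge> 1 \<Longrightarrow> empirical_dist h g n m x y \<le> diameter (UNIV :: 'a set)"
  by (intro wasserstein_le_diameter empirical_measure_in_borel_prob_measures)

lemma empirical_dist_commute: "n \<ge> 1 \<Longrightarrow> m \<ge> 1 \<Longrightarrow> empirical_dist h g n m x y = empirical_dist g h m n y x"
  by (intro wasserstein_commute empirical_measure_in_borel_prob_measures)

lemma empirical_dist_triangle:
  "n \<ge> 1 \<Longrightarrow> m \<ge> 1 \<Longrightarrow> k \<ge> 1 \<Longrightarrow>
    empirical_dist h g n m x z \<le> empirical_dist h u n k x y + empirical_dist u g k m y z"
  by (intro wasserstein_triangle empirical_measure_in_borel_prob_measures)

text \<open>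
  The coupling visits both orbits at the same random time.
\<close>

lemma empirical_dist_le_average:
  assumes "n \<ge> 1"
  shows "empirical_dist h g n n x y \<le> (\<Sum>i<n. dist ((h ^^ i) x) ((g ^^ i) y)) / n"
proof -
  have "{..<n} \<noteq> {}" using assms by (simp add: lessThan_empty_iff)
  have "empirical_dist h g n n x y \<le> (\<integral>i. dist ((h ^^ i) x) ((g ^^ i) y) \<partial>measure_pmf (pmf_of_set {..<n}))"
    unfolding empirical_measure_eq_distr[OF assms]
    by (rule wasserstein_le_expectation) (auto intro: measure_pmf.prob_space_axioms)
  with \<open>{..<n} \<noteq> {}\<close> show ?thesis by (simp add: integral_pmf_of_set)
qed

lemma empirical_dist_le:
  assumes "n \<ge> 1" and "\<And>i. i < n \<Longrightarrow> dist ((h ^^ i) x) ((g ^^ i) y) \<le> e"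
  shows "empirical_dist h g n n x y \<le> e"
proof -
  have "(\<Sum>i<n. dist ((h ^^ i) x) ((g ^^ i) y)) \<le> of_nat (card {..<n}) * e"
    by (rule sum_bounded_above) (use assms in auto)
  then have "(\<Sum>i<n. dist ((h ^^ i) x) ((g ^^ i) y)) / n \<le> e"
    using assms(1) by (simp add: field_simps)
  with empirical_dist_le_average[OF assms(1)] show ?thesis by (rule order_trans)
qed

lemma continuous_on_funpow:
  fixes f :: "'a :: topological_space \<Rightarrow> 'a"
  assumes "continuous_on UNIV f"
  shows "continuous_on UNIV (f ^^ i)"
proof (induction i)
  case (Suc i)
  then show ?case
    using continuous_on_compose2[OF assms Suc] by (simp add: comp_def)
qed (simp add: id_def)

lemma continuous_on_empirical_dist:
  assumes h: "continuous_on UNIV h" and g: "continuous_on UNIV g" and nm: "n \<ge> 1" "m \<ge> 1"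
  shows "continuous_on UNIV (\<lambda>x. empirical_dist h g n m x x)"
  unfolding continuous_on_def
proof (intro ballI)
  fix x :: 'a
  define b where "b y = (\<Sum>i<n. dist ((h ^^ i) y) ((h ^^ i) x)) / n + (\<Sum>i<m. dist ((g ^^ i) y) ((g ^^ i) x)) / m" for y
  have lim: "((\<lambda>y. (f ^^ i) y) \<longlongrightarrow> (f ^^ i) x) (at x)" if "continuous_on UNIV f" for f :: "'a \<Rightarrow> 'a" and i
    using continuous_on_funpow[OF that, of i] by (auto simp: continuous_on_def)
  have "(b \<longlongrightarrow> (\<Sum>i<n. dist ((h ^^ i) x) ((h ^^ i) x)) / n + (\<Sum>i<m. dist ((g ^^ i) x) ((g ^^ i) x)) / m) (at x)"
    unfolding b_def using nm by (intro tendsto_intros lim h g) auto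
  then have b: "(b \<longlongrightarrow> 0) (at x)" by simp
  have "norm (empirical_dist h g n m y y - empirical_dist h g n m x x) \<le> b y" for y
  proof -
    have "empirical_dist h g n m y y \<le> empirical_dist h h n n y x + empirical_dist h g n m x x + empirical_dist g g m m x y"
      using empirical_dist_triangle[OF nm nm(1), of h y g y h x] empirical_dist_triangle[OF nm nm(2), of h x g y g x]
      by linarith
    moreover have "empirical_dist h g n m x x \<le> empirical_dist h h n n x y + empirical_dist h g n m y y + empirical_dist g g m m y x"
      using empirical_dist_triangle[OF nm nm(1), of h x g x h y] empirical_dist_triangle[OF nm nm(2), of h y g x g y]
      by linarith
    moreover have "empirical_dist h h n n x y = empirical_dist h h n n y x"
      "empirical_dist g g m m x y = empirical_dist g g m m y x"
      using nm by (auto intro: empirical_dist_commute)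
    moreover have "empirical_dist h h n n y x + empirical_dist g g m m y x \<le> b y"
      unfolding b_def using nm by (intro add_mono empirical_dist_le_average)
    ultimately show ?thesis by (simp add: abs_le_iff)
  qed
  then have "((\<lambda>y. empirical_dist h g n m y y - empirical_dist h g n m x x) \<longlongrightarrow> 0) (at x)"
    by (intro Lim_null_comparison[OF _ b]) auto
  then show "((\<lambda>y. empirical_dist h g n m y y) \<longlongrightarrow> empirical_dist h g n m x x) (at x within UNIV)"
    by (simp add: LIM_zero_iff)
qed

section \<open>The oscillation of the empirical measures\<close>

definition oscillation ::
  "nat \<Rightarrow> ('a :: compact_metric_space \<Rightarrow> 'a) \<Rightarrow> ('a \<Rightarrow> 'a) \<Rightarrow> 'a \<Rightarrow> real" where
  "oscillation N h g x = (SUP (n, m) \<in> {max N 1..} \<times> {max N 1..}. empirical_dist h g n m x x)"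

lemma Delta_N_eq: "Delta_N \<mu> N h g = (\<integral>x. oscillation N h g x \<partial>\<mu>)"
  by (simp add: Delta_N_def oscillation_def)

lemma bdd_above_oscillation:
  "bdd_above ((\<lambda>(n, m). empirical_dist h g n m x x) ` ({max N 1..} \<times> {max N 1..}))"
  by (rule bdd_aboveI) (auto intro!: empirical_dist_le_diameter)

lemma empirical_dist_le_oscillation:
  assumes "n \<ge> max N 1" "m \<ge> max N 1"
  shows "empirical_dist h g n m x x \<le> oscillation N h g x"
  unfolding oscillation_def
  using cSUP_upper[OF _ bdd_above_oscillation[of h x g N], of "(n, m)"] assms by simp

lemma oscillation_le:
  assumes "\<And>n m. n \<ge> max N 1 \<Longrightarrow> m \<ge> max N 1 \<Longrightarrow> empirical_dist h g n m x x \<le> c"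
  shows "oscillation N h g x \<le> c"
  unfolding oscillation_def by (rule cSUP_least) (use assms in auto)

lemma oscillation_nonneg: "0 \<le> oscillation N h g x"
  using empirical_dist_le_oscillation[of N "max N 1" "max N 1" h x g]
    empirical_dist_nonneg[of "max N 1" "max N 1" h x g x] by simp

lemma oscillation_le_diameter:
  fixes x :: "'a :: compact_metric_space"
  shows "oscillation N h g x \<le> diameter (UNIV :: 'a set)"
  by (rule oscillation_le) (simp add: empirical_dist_le_diameter)

lemma oscillation_antimono: "N \<le> M \<Longrightarrow> oscillation M h g x \<le> oscillation N h g x"
  by (intro oscillation_le empirical_dist_le_oscillation) auto

text \<open>
  Both maps are brought back to the initial time \<open>max N 1\<close>, where their empirical measures can be
  compared. This separates the two-map oscillation into one-map oscillations and a distance at a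
  single time.
\<close>

lemma oscillation_le_self_oscillations:
  "oscillation N h g x \<le> oscillation N h h x + empirical_dist h g (max N 1) (max N 1) x x + oscillation N g g x"
proof (rule oscillation_le)
  fix n m assume nm: "max N 1 \<le> n" "max N 1 \<le> m"
  have "empirical_dist h g n m x x \<le> empirical_dist h h n (max N 1) x x + empirical_dist h g (max N 1) m x x"
    using nm by (intro empirical_dist_triangle) auto
  also have "empirical_dist h g (max N 1) m x x \<le> empirical_dist h g (max N 1) (max N 1) x x + empirical_dist g g (max N 1) m x x"
    using nm by (intro empirical_dist_triangle) auto
  also have "empirical_dist h h n (max N 1) x x \<le> oscillation N h h x"
    using nm by (intro empirical_dist_le_oscillation) auto
  also have "empirical_dist g g (max N 1) m x x \<le> oscillation N g g x"
    using nm by (intro empirical_dist_le_oscillation) auto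
  finally show "empirical_dist h g n m x x \<le> oscillation N h h x + empirical_dist h g (max N 1) (max N 1) x x + oscillation N g g x"
    by simp
qed

lemma borel_measurable_empirical_dist:
  assumes "continuous_on UNIV h" "continuous_on UNIV g" "n \<ge> 1" "m \<ge> 1"
  shows "(\<lambda>x. empirical_dist h g n m x x) \<in> borel_measurable borel"
  by (rule borel_measurable_continuous_onI[OF continuous_on_empirical_dist[OF assms]])

lemma borel_measurable_oscillation:
  assumes "continuous_on UNIV h" "continuous_on UNIV g"
  shows "oscillation N h g \<in> borel_measurable borel"
  unfolding oscillation_def[abs_def]
  by (rule borel_measurable_cSUP)
    (auto simp: split_beta' intro!: borel_measurable_empirical_dist assms bdd_aboveI empirical_dist_le_diameter)

text \<open>
  A sequence of empirical measures converges iff it is Cauchy, and the oscillation measures the failure of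
  the Cauchy property. The right-hand side involves only countable quantifiers over Borel
  functions if \<open>f\<close> is continuous, so it also yields that the set of points of convergence is Borel.
\<close>

lemma empirical_convergent_iff_oscillation:
  "empirical_convergent f x \<longleftrightarrow> (\<forall>k :: nat. \<exists>N. oscillation N f f x < 1 / Suc k)"
proof
  assume "empirical_convergent f x"
  then obtain \<nu> where \<nu>: "\<nu> \<in> borel_prob_measures" "(\<lambda>n. wasserstein (empirical_measure f n x) \<nu>) \<longlonglongrightarrow> 0"
    by (auto simp: empirical_convergent_def)
  show "\<forall>k :: nat. \<exists>N. oscillation N f f x < 1 / Suc k"
  proof
    fix k :: nat
    define e where "e = 1 / real (Suc k) / 3"
    have "e > 0" by (simp add: e_def)
    from order_tendstoD(2)[OF \<nu>(2) this] obtain N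
      where N: "\<And>n. n \<ge> N \<Longrightarrow> wasserstein (empirical_measure f n x) \<nu> < e"
      by (auto simp: eventually_sequentially)
    have "oscillation N f f x \<le> e + e"
    proof (rule oscillation_le)
      fix n m assume nm: "max N 1 \<le> n" "max N 1 \<le> m"
      have P: "empirical_measure f n x \<in> borel_prob_measures" "empirical_measure f m x \<in> borel_prob_measures"
        using nm by (auto intro: empirical_measure_in_borel_prob_measures)
      have "empirical_dist f f n m x x \<le> wasserstein (empirical_measure f n x) \<nu> + wasserstein \<nu> (empirical_measure f m x)"
        by (rule wasserstein_triangle) fact+
      then show "empirical_dist f f n m x x \<le> e + e"
        using N[of n] N[of m] nm wasserstein_commute[OF \<nu>(1) P(2)] by simp
    qed
    also have "\<dots> < 1 / Suc k"
      using \<open>e > 0\<close> unfolding e_def by (simp add: field_simps)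
    finally show "\<exists>N. oscillation N f f x < 1 / Suc k" ..
  qed
next
  assume osc: "\<forall>k :: nat. \<exists>N. oscillation N f f x < 1 / Suc k"
  \<comment> \<open>The shift avoids time 0, at which the empirical measure is not a probability measure.\<close>
  have "\<exists>\<nu>\<in>borel_prob_measures. (\<lambda>n. wasserstein (empirical_measure f (Suc n) x) \<nu>) \<longlonglongrightarrow> 0"
  proof (rule wasserstein_complete)
    show "empirical_measure f (Suc n) x \<in> borel_prob_measures" for n
      by (rule empirical_measure_in_borel_prob_measures) simp
    fix e :: real assume "e > 0"
    then obtain k where "1 / real (Suc k) < e"
      using reals_Archimedean[of e] by (auto simp: inverse_eq_divide)
    moreover from osc obtain N where "oscillation N f f x < 1 / Suc k" by blast
    ultimately have "empirical_dist f f (Suc m) (Suc n) x x < e" if "m \<ge> N" "n \<ge> N" for m n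
      using empirical_dist_le_oscillation[of N "Suc m" "Suc n" f x f] that by simp
    then show "\<exists>N. \<forall>m\<ge>N. \<forall>n\<ge>N. empirical_dist f f (Suc m) (Suc n) x x < e" by blast
  qed
  then show "empirical_convergent f x"
    unfolding empirical_convergent_def by (auto intro: LIMSEQ_imp_Suc)
qed

lemma sets_empirical_convergent:
  assumes "continuous_on UNIV f"
  shows "{x. \<not> empirical_convergent f x} \<in> sets borel"
proof -
  have [measurable]: "oscillation N f f \<in> borel_measurable borel" for N
    by (rule borel_measurable_oscillation) fact+
  have "{x \<in> space borel. \<not> (\<forall>k :: nat. \<exists>N. oscillation N f f x < 1 / Suc k)} \<in> sets borel"
    by measurable
  then show ?thesis
    by (simp add: empirical_convergent_iff_oscillation)
qed

section \<open>Integrated oscillation\<close>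

locale map_family =
  fixes \<mu> :: "'a :: compact_metric_space measure" and T :: "('a \<Rightarrow> 'a) topology"
  assumes \<mu>: "\<mu> \<in> borel_prob_measures"
    and continuous: "f \<in> topspace T \<Longrightarrow> continuous_on UNIV f"
    and finer: "finer_topology T (subtopology C0_topology (topspace T))"
begin

sublocale prob_space \<mu>
  by (rule borel_prob_measuresD(1)[OF \<mu>])

lemma sets_\<mu> [measurable_cong]: "sets \<mu> = sets borel"
  by (rule borel_prob_measuresD(2)[OF \<mu>])

lemma oscillation_measurable [measurable]:
  assumes "h \<in> topspace T" "g \<in> topspace T"
  shows "oscillation N h g \<in> borel_measurable \<mu>"
  using borel_measurable_oscillation[OF continuous continuous, OF assms] borel_prob_measuresD(4)[OF \<mu>]
  by simp

lemma integrable_oscillation: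
  assumes "h \<in> topspace T" "g \<in> topspace T"
  shows "integrable \<mu> (oscillation N h g)"
  by (rule integrable_const_bound[of _ "diameter (UNIV :: 'a set)"])
    (use assms in \<open>auto simp: oscillation_nonneg oscillation_le_diameter\<close>)

lemma Delta_N_nonneg: "0 \<le> Delta_N \<mu> N h g"
  unfolding Delta_N_eq by (rule integral_nonneg_AE) (simp add: oscillation_nonneg)

lemma Delta_N_le_diameter:
  assumes "h \<in> topspace T" "g \<in> topspace T"
  shows "Delta_N \<mu> N h g \<le> diameter (UNIV :: 'a set)"
  unfolding Delta_N_eq
  using integral_mono[OF integrable_oscillation[OF assms] integrable_const, of N "diameter (UNIV :: 'a set)"]
  by (simp add: oscillation_le_diameter prob_space)

lemma Delta_N_antimono:
  assumes "h \<in> topspace T" "g \<in> topspace T" "N \<le> M"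
  shows "Delta_N \<mu> M h g \<le> Delta_N \<mu> N h g"
  unfolding Delta_N_eq
  by (intro integral_mono integrable_oscillation assms oscillation_antimono)

text \<open>
  Otherwise the oscillation would tend to 0 almost everywhere, and so would its integral by dominated
  convergence.
\<close>

lemma non_statistical_if_Delta_N_bounded_below:
  assumes f: "f \<in> topspace T" and "c > 0" and c: "\<And>N. c \<le> Delta_N \<mu> N f f"
  shows "non_statistical \<mu> f"
proof (rule ccontr)
  have [measurable]: "oscillation N f f \<in> borel_measurable \<mu>" for N
    by (rule oscillation_measurable) fact+
  assume "\<not> non_statistical \<mu> f"
  then have "{x. \<not> empirical_convergent f x} \<in> null_sets \<mu>"
    using sets_empirical_convergent[OF continuous[OF f]]
    by (auto simp: non_statistical_def sets_\<mu> intro!: null_setsI)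
  then have AE_conv: "AE x in \<mu>. empirical_convergent f x"
    using AE_not_in by fastforce
  have "(\<lambda>N. \<integral>x. oscillation N f f x \<partial>\<mu>) \<longlonglongrightarrow> (\<integral>x. 0 \<partial>\<mu>)"
  proof (rule integral_dominated_convergence[where w="\<lambda>_. diameter (UNIV :: 'a set)"])
    show "AE x in \<mu>. (\<lambda>N. oscillation N f f x) \<longlonglongrightarrow> 0"
      using AE_conv
    proof eventually_elim
      case (elim x)
      show ?case
      proof (rule LIMSEQ_I)
        fix e :: real assume "e > 0"
        then obtain k where "1 / real (Suc k) < e"
          using reals_Archimedean[of e] by (auto simp: inverse_eq_divide)
        moreover from elim obtain N where "oscillation N f f x < 1 / Suc k"
          unfolding empirical_convergent_iff_oscillation by blast
        ultimately have "norm (oscillation M f f x - 0) < e" if "M \<ge> N" for M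
          using oscillation_antimono[OF that, of f f x] oscillation_nonneg[of M f f x] by simp
        then show "\<exists>N. \<forall>M\<ge>N. norm (oscillation M f f x - 0) < e" by blast
      qed
    qed
  qed (auto simp: oscillation_nonneg oscillation_le_diameter)
  then have "(\<lambda>N. Delta_N \<mu> N f f) \<longlonglongrightarrow> 0"
    by (simp add: Delta_N_eq)
  then have "c \<le> 0"
    by (rule LIMSEQ_le_const) (use c in auto)
  with \<open>c > 0\<close> show False by simp
qed

section \<open>Neighbourhoods of a map\<close>

text \<open>
  The topology enters the proof through this lemma: being finer than the \<open>C\<^sup>0\<close> topology, it contains
  the traces of uniform balls.
\<close>

lemma uniformly_close_neighbourhood:
  assumes f: "f \<in> topspace T" and "e > 0"
  obtains V where "openin T V" "f \<in> V" "\<And>g x. g \<in> V \<Longrightarrow> dist (f x) (g x) < e"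
proof -
  let ?m = "cfunspace euclidean euclidean_metric :: ('a \<Rightarrow> 'a) metric"
  interpret C0: Metric_space "mspace ?m" "mdist ?m"
    by (rule Metric_space_mspace_mdist)
  let ?V = "mball_of ?m f e \<inter> topspace T"
  have mem: "g \<in> mspace ?m" if "g \<in> topspace T" for g
    using topspace_C0_topology continuous[OF that] unfolding C0_topology_def by auto
  have "openin C0_topology (mball_of ?m f e)"
    unfolding C0_topology_def mtopology_of_def mball_of_def by (rule C0.openin_mball)
  then have "openin (subtopology C0_topology (topspace T)) ?V"
    by (auto simp: openin_subtopology)
  then have "openin T ?V"
    using finer by (simp add: finer_topology_def)
  moreover have "f \<in> ?V"
    using f mem[OF f] \<open>e > 0\<close> C0.mdist_zero[OF mem[OF f]] by simp
  moreover have "dist (f x) (g x) < e" if "g \<in> ?V" for g x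
  proof -
    have g: "g \<in> mspace ?m" "mdist ?m f g < e"
      using that by auto
    have "mdist euclidean_metric (f x) (g x) \<le> mdist ?m f g"
      by (rule mdist_cfunspace_imp_mdist_le[OF mem[OF f] g(1) order_refl]) simp
    with g(2) show ?thesis by simp
  qed
  ultimately show ?thesis by (rule that)
qed

text \<open>
  Induction on the number of iterates: by uniform continuity of \<open>f\<close>, a sufficiently small error made in the first
  \<open>n\<close> steps stays below \<open>e / 2\<close> under one more application of \<open>f\<close>, and replacing this last \<open>f\<close> by \<open>g\<close> costs
  another \<open>e / 2\<close>.
\<close>

lemma iterates_close_neighbourhood:
  assumes f: "f \<in> topspace T" and "e > 0"
  shows "\<exists>V. openin T V \<and> f \<in> V \<and> (\<forall>g\<in>V. \<forall>i\<le>n. \<forall>x. dist ((f ^^ i) x) ((g ^^ i) x) < e)"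
  using \<open>e > 0\<close>
proof (induction n arbitrary: e)
  case 0
  then show ?case
    using f by (intro exI[of _ "topspace T"]) auto
next
  case (Suc n)
  have "uniformly_continuous_on UNIV f"
    by (rule compact_uniformly_continuous[OF continuous[OF f] compact_UNIV])
  then obtain d where "d > 0" and d: "\<And>x y. dist x y < d \<Longrightarrow> dist (f x) (f y) < e / 2"
    using Suc.prems unfolding uniformly_continuous_on_def by (metis UNIV_I dist_commute half_gt_zero)
  obtain V where V: "openin T V" "f \<in> V" "\<And>g i x. g \<in> V \<Longrightarrow> i \<le> n \<Longrightarrow> dist ((f ^^ i) x) ((g ^^ i) x) < d"
    using Suc.IH[OF \<open>d > 0\<close>] by blast
  obtain W where W: "openin T W" "f \<in> W" "\<And>g x. g \<in> W \<Longrightarrow> dist (f x) (g x) < e / 2"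
    using uniformly_close_neighbourhood[OF f half_gt_zero[OF Suc.prems]] by metis
  have "dist ((f ^^ i) x) ((g ^^ i) x) < e" if g: "g \<in> V \<inter> W" and i: "i \<le> Suc n" for g i x
  proof (cases i)
    case 0
    then show ?thesis using Suc.prems by simp
  next
    case (Suc j)
    have "dist (f ((f ^^ j) x)) (f ((g ^^ j) x)) < e / 2"
      using V(3)[of g j x] g i Suc by (intro d) auto
    moreover have "dist (f ((g ^^ j) x)) (g ((g ^^ j) x)) < e / 2"
      using W(3) g by auto
    ultimately show ?thesis
      using dist_triangle[of "f ((f ^^ j) x)" "g ((g ^^ j) x)" "f ((g ^^ j) x)"] Suc by simp
  qed
  then show ?case
    using V(1,2) W(1,2) by (intro exI[of _ "V \<inter> W"]) auto
qed

lemma empirical_dist_close_neighbourhood: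
  assumes f: "f \<in> topspace T" and "e > 0"
  obtains V where "openin T V" "f \<in> V"
    "\<And>g n x. g \<in> V \<Longrightarrow> 1 \<le> n \<Longrightarrow> n \<le> M \<Longrightarrow> empirical_dist f g n n x x \<le> e"
proof -
  obtain V where V: "openin T V" "f \<in> V" "\<forall>g\<in>V. \<forall>i\<le>M. \<forall>x. dist ((f ^^ i) x) ((g ^^ i) x) < e"
    using iterates_close_neighbourhood[OF assms, of M] by blast
  have "empirical_dist f g n n x x \<le> e" if "g \<in> V" "1 \<le> n" "n \<le> M" for g n x
    by (rule empirical_dist_le) (use V(3) that in \<open>auto intro!: less_imp_le\<close>)
  with V that show ?thesis by blast
qed

section \<open>The instability of a map\<close>

definition sup_Delta_N :: "nat \<Rightarrow> ('a \<Rightarrow> 'a) set \<Rightarrow> real" where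
  "sup_Delta_N N V = (SUP (h, g)\<in>V \<times> V. Delta_N \<mu> N h g)"

definition limsup_Delta_N :: "nat \<Rightarrow> ('a \<Rightarrow> 'a) \<Rightarrow> real" where
  "limsup_Delta_N N f = (INF V\<in>neighbourhoods T f. sup_Delta_N N V)"

lemma Delta_eq: "Delta \<mu> T f = lim (\<lambda>N. limsup_Delta_N N f)"
  by (simp add: Delta_def limsup_Delta_N_def sup_Delta_N_def)

lemma neighbourhoodsD:
  assumes "V \<in> neighbourhoods T f"
  shows "V \<subseteq> topspace T" "f \<in> V" "V \<times> V \<noteq> {}"
proof -
  show "V \<subseteq> topspace T" "f \<in> V"
    using assms interior_of_subset[of T V] by (auto simp: neighbourhoods_def)
  then show "V \<times> V \<noteq> {}" by auto
qed

lemma openin_in_neighbourhoods: "openin T V \<Longrightarrow> f \<in> V \<Longrightarrow> V \<in> neighbourhoods T f"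
  using openin_subset by (auto simp: neighbourhoods_def interior_of_openin)

lemma Delta_N_le_sup:
  assumes V: "V \<subseteq> topspace T" and "h \<in> V" "g \<in> V"
  shows "Delta_N \<mu> N h g \<le> sup_Delta_N N V"
proof -
  have "bdd_above ((\<lambda>(h, g). Delta_N \<mu> N h g) ` (V \<times> V))"
    using V by (intro bdd_aboveI[of _ "diameter (UNIV :: 'a set)"]) (auto intro: Delta_N_le_diameter)
  from cSUP_upper[OF _ this, of "(h, g)"] show ?thesis
    using assms by (simp add: sup_Delta_N_def)
qed

lemma sup_Delta_N_le:
  assumes "V \<in> neighbourhoods T f" and "\<And>h g. h \<in> V \<Longrightarrow> g \<in> V \<Longrightarrow> Delta_N \<mu> N h g \<le> c"
  shows "sup_Delta_N N V \<le> c"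
  unfolding sup_Delta_N_def by (rule cSUP_least) (use assms neighbourhoodsD(3) in auto)

lemma sup_Delta_N_nonneg:
  assumes "V \<in> neighbourhoods T f"
  shows "0 \<le> sup_Delta_N N V"
  using Delta_N_le_sup[OF neighbourhoodsD(1,2,2), OF assms assms assms] Delta_N_nonneg order_trans by blast

lemma limsup_Delta_N_le_sup:
  assumes "V \<in> neighbourhoods T f"
  shows "limsup_Delta_N N f \<le> sup_Delta_N N V"
  unfolding limsup_Delta_N_def
  by (rule cINF_lower[OF _ assms]) (auto intro!: bdd_belowI[of _ 0] sup_Delta_N_nonneg)

lemma neighbourhoods_nonempty: "f \<in> topspace T \<Longrightarrow> neighbourhoods T f \<noteq> {}"
  using openin_in_neighbourhoods[of "topspace T" f] by auto

lemma limsup_Delta_N_antimono: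
  assumes f: "f \<in> topspace T" and "N \<le> M"
  shows "limsup_Delta_N M f \<le> limsup_Delta_N N f"
  unfolding limsup_Delta_N_def[of N]
proof (rule cINF_greatest[OF neighbourhoods_nonempty[OF f]])
  fix V assume V: "V \<in> neighbourhoods T f"
  have "sup_Delta_N M V \<le> sup_Delta_N N V"
  proof (rule sup_Delta_N_le[OF V])
    fix h g assume "h \<in> V" "g \<in> V"
    then show "Delta_N \<mu> M h g \<le> sup_Delta_N N V"
      using neighbourhoodsD(1)[OF V] \<open>N \<le> M\<close>
      by (intro order_trans[OF Delta_N_antimono Delta_N_le_sup]) auto
  qed
  with limsup_Delta_N_le_sup[OF V] show "limsup_Delta_N M f \<le> sup_Delta_N N V"
    by (rule order_trans)
qed

lemma limsup_Delta_N_tendsto_Delta: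
  assumes f: "f \<in> topspace T"
  shows "(\<lambda>N. limsup_Delta_N N f) \<longlonglongrightarrow> Delta \<mu> T f"
proof -
  have "0 \<le> limsup_Delta_N N f" for N
    unfolding limsup_Delta_N_def
    by (rule cINF_greatest[OF neighbourhoods_nonempty[OF f] sup_Delta_N_nonneg])
  moreover have "decseq (\<lambda>N. limsup_Delta_N N f)"
    by (intro decseq_SucI limsup_Delta_N_antimono f) simp
  ultimately have "convergent (\<lambda>N. limsup_Delta_N N f)"
    by (metis decseq_convergent convergentI)
  then show ?thesis
    unfolding Delta_eq by (simp add: convergent_LIMSEQ_iff)
qed

lemma Delta_le_limsup_Delta_N:
  assumes f: "f \<in> topspace T"
  shows "Delta \<mu> T f \<le> limsup_Delta_N N f"
  by (rule LIMSEQ_le_const2[OF limsup_Delta_N_tendsto_Delta[OF f]])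
    (use limsup_Delta_N_antimono[OF f] in blast)

lemma Delta_le_sup_Delta_N:
  assumes "V \<in> neighbourhoods T f"
  shows "Delta \<mu> T f \<le> sup_Delta_N N V"
  using neighbourhoodsD[OF assms] Delta_le_limsup_Delta_N[of f N] limsup_Delta_N_le_sup[OF assms, of N]
  by auto

text \<open>
  Upper semicontinuity: a neighbourhood that witnesses \<open>Delta < c\<close> at \<open>f\<close> is also a neighbourhood of
  each of its interior points.
\<close>

lemma openin_Delta_less: "openin T {f \<in> topspace T. Delta \<mu> T f < c}"
proof (subst openin_subopen, intro ballI)
  fix f assume "f \<in> {f \<in> topspace T. Delta \<mu> T f < c}"
  then have f: "f \<in> topspace T" "Delta \<mu> T f < c" by auto
  from order_tendstoD(2)[OF limsup_Delta_N_tendsto_Delta[OF f(1)] f(2)]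
  obtain N where "limsup_Delta_N N f < c"
    by (auto simp: eventually_sequentially)
  then obtain V where V: "V \<in> neighbourhoods T f" "sup_Delta_N N V < c"
    unfolding limsup_Delta_N_def
    using cINF_greatest[OF neighbourhoods_nonempty[OF f(1)], of c "sup_Delta_N N"] by (meson not_le)
  have "T interior_of V \<subseteq> {f \<in> topspace T. Delta \<mu> T f < c}"
  proof
    fix g assume g: "g \<in> T interior_of V"
    then have "V \<in> neighbourhoods T g"
      using neighbourhoodsD(1)[OF V(1)] by (simp add: neighbourhoods_def)
    from Delta_le_sup_Delta_N[OF this, of N] V(2) neighbourhoodsD[OF this]
    show "g \<in> {f \<in> topspace T. Delta \<mu> T f < c}" by auto
  qed
  moreover have "f \<in> T interior_of V"
    using V(1) by (simp add: neighbourhoods_def)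
  ultimately show "\<exists>W. openin T W \<and> f \<in> W \<and> W \<subseteq> {f \<in> topspace T. Delta \<mu> T f < c}"
    using openin_interior_of by blast
qed

text \<open>
  The key estimate. It relates the instability of \<open>f\<close>, which compares two different maps near \<open>f\<close>, to
  the oscillation of single maps near \<open>f\<close>: each of the two maps contributes at most \<open>c\<close>, and their
  distance at the one time \<open>max N 1\<close> is arbitrarily small on a small neighbourhood.
\<close>

lemma Delta_le_if_self_oscillation_le:
  assumes V: "openin T V" "f \<in> V" and c: "\<And>F. F \<in> V \<Longrightarrow> Delta_N \<mu> N F F \<le> c"
  shows "Delta \<mu> T f \<le> 2 * c"
proof (rule field_le_epsilon)
  fix e :: real assume "e > 0"
  have f: "f \<in> topspace T"
    using V openin_subset by blast
  obtain W where W: "openin T W" "f \<in> W"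
    "\<And>g n x. g \<in> W \<Longrightarrow> 1 \<le> n \<Longrightarrow> n \<le> max N 1 \<Longrightarrow> empirical_dist f g n n x x \<le> e / 2"
    using empirical_dist_close_neighbourhood[OF f, of "e / 2" "max N 1"] \<open>e > 0\<close> by auto
  have VW: "V \<inter> W \<in> neighbourhoods T f"
    using V W by (intro openin_in_neighbourhoods) auto
  have "Delta \<mu> T f \<le> sup_Delta_N N (V \<inter> W)"
    by (rule Delta_le_sup_Delta_N[OF VW])
  also have "\<dots> \<le> 2 * c + e"
  proof (rule sup_Delta_N_le[OF VW])
    fix h g assume hg: "h \<in> V \<inter> W" "g \<in> V \<inter> W"
    then have hg_T: "h \<in> topspace T" "g \<in> topspace T"
      using neighbourhoodsD(1)[OF VW] by auto
    have "oscillation N h g x \<le> oscillation N h h x + e + oscillation N g g x" for x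
    proof -
      have "empirical_dist h g (max N 1) (max N 1) x x
          \<le> empirical_dist h f (max N 1) (max N 1) x x + empirical_dist f g (max N 1) (max N 1) x x"
        by (rule empirical_dist_triangle) auto
      also have "empirical_dist h f (max N 1) (max N 1) x x = empirical_dist f h (max N 1) (max N 1) x x"
        by (rule empirical_dist_commute) auto
      finally have "empirical_dist h g (max N 1) (max N 1) x x \<le> e"
        using W(3)[of h "max N 1" x] W(3)[of g "max N 1" x] hg by simp
      with oscillation_le_self_oscillations[of N h g x] show ?thesis by simp
    qed
    then have "Delta_N \<mu> N h g \<le> (\<integral>x. oscillation N h h x + e + oscillation N g g x \<partial>\<mu>)"
      unfolding Delta_N_eq
      by (intro integral_mono Bochner_Integration.integrable_add integrable_oscillation hg_T integrable_const)
    also have "\<dots> = Delta_N \<mu> N h h + e + Delta_N \<mu> N g g"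
      unfolding Delta_N_eq
      by (simp add: Bochner_Integration.integral_add integrable_oscillation hg_T prob_space)
    finally show "Delta_N \<mu> N h g \<le> 2 * c + e"
      using c[of h] c[of g] hg by simp
  qed
  finally show "Delta \<mu> T f \<le> 2 * c + e" .
qed

text \<open>
  Lower semicontinuity: the oscillation is the limit of its truncations \<open>S M\<close> to finitely many times.
  Some truncation already has integral greater than \<open>c\<close>, and a truncation involves only finitely many
  iterates, so it varies little on a small neighbourhood.
\<close>

lemma openin_Delta_N_self_greater: "openin T {F \<in> topspace T. c < Delta_N \<mu> N F F}"
proof (subst openin_subopen, intro ballI)
  fix F assume "F \<in> {F \<in> topspace T. c < Delta_N \<mu> N F F}"
  then have F: "F \<in> topspace T" "c < Delta_N \<mu> N F F" by auto
  define I where "I M = {max N 1..max N 1 + M} \<times> {max N 1..max N 1 + M}" for M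
  define S where "S M x = (SUP (n, m)\<in>I M. empirical_dist F F n m x x)" for M x
  have I: "finite (I M)" "I M \<noteq> {}" for M
    by (auto simp: I_def)
  have bdd: "bdd_above ((\<lambda>(n, m). empirical_dist F F n m x x) ` I M)" for M x
    using I(1) by auto
  have S_upper: "empirical_dist F F n m x x \<le> S M x" if "(n, m) \<in> I M" for n m M x
    unfolding S_def using cSUP_upper[OF that bdd] by simp
  have S_le: "S M x \<le> oscillation N F F x" for M x
    unfolding S_def
    by (rule cSUP_least[OF I(2)]) (auto simp: I_def intro!: empirical_dist_le_oscillation)
  have S_nonneg: "0 \<le> S M x" for M x
    using S_upper[of "max N 1" "max N 1" M x] empirical_dist_nonneg[of "max N 1" "max N 1" F x F x]
    by (simp add: I_def)
  have S_measurable[measurable]: "S M \<in> borel_measurable \<mu>" for M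
  proof -
    have "(\<lambda>x. SUP i\<in>I M. (case i of (n, m) \<Rightarrow> empirical_dist F F n m x x)) \<in> borel_measurable borel"
    proof (rule borel_measurable_cSUP[OF countable_finite[OF I(1)] _ bdd])
      show "(\<lambda>x. case i of (n, m) \<Rightarrow> empirical_dist F F n m x x) \<in> borel_measurable borel" if "i \<in> I M" for i
        using that by (auto simp: I_def intro!: borel_measurable_empirical_dist continuous F)
    qed
    then show ?thesis
      unfolding S_def[abs_def] by (simp add: borel_prob_measuresD(4)[OF \<mu>])
  qed
  have "(\<lambda>M. \<integral>x. S M x \<partial>\<mu>) \<longlonglongrightarrow> (\<integral>x. oscillation N F F x \<partial>\<mu>)"
  proof (rule integral_dominated_convergence[where w="\<lambda>_. diameter (UNIV :: 'a set)"])
    show "AE x in \<mu>. (\<lambda>M. S M x) \<longlonglongrightarrow> oscillation N F F x"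
    proof (rule AE_I2, rule LIMSEQ_I)
      fix x and e :: real assume "e > 0"
      then have "oscillation N F F x - e < oscillation N F F x" by simp
      then obtain n m where nm: "n \<ge> max N 1" "m \<ge> max N 1" "oscillation N F F x - e < empirical_dist F F n m x x"
        using oscillation_le[of N F x F "oscillation N F F x - e"] by (meson not_le)
      have "norm (S M x - oscillation N F F x) < e" if "M \<ge> max n m" for M
      proof -
        have "(n, m) \<in> I M"
          using nm that by (auto simp: I_def)
        then show ?thesis
          using S_upper[of n m M x] S_le[of M x] nm(3) by simp
      qed
      then show "\<exists>M0. \<forall>M\<ge>M0. norm (S M x - oscillation N F F x) < e" by blast
    qed
    show "AE x in \<mu>. norm (S M x) \<le> diameter (UNIV :: 'a set)" for M
      using S_nonneg order_trans[OF S_le oscillation_le_diameter] by (intro AE_I2) simp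
  qed (use F in auto)
  from order_tendstoD(1)[OF this[folded Delta_N_eq] F(2)] obtain M where M: "c < (\<integral>x. S M x \<partial>\<mu>)"
    by (auto simp: eventually_sequentially)
  \<comment> \<open>Half of the gap, so that a loss of \<open>e\<close> keeps the integral above \<open>c\<close>.\<close>
  define e where "e = ((\<integral>x. S M x \<partial>\<mu>) - c) / 2"
  have "e > 0" using M by (simp add: e_def)
  obtain V where V: "openin T V" "F \<in> V"
    "\<And>G n x. G \<in> V \<Longrightarrow> 1 \<le> n \<Longrightarrow> n \<le> max N 1 + M \<Longrightarrow> empirical_dist F G n n x x \<le> e / 2"
    using empirical_dist_close_neighbourhood[OF F(1), of "e / 2" "max N 1 + M"] \<open>e > 0\<close> by auto
  have "c < Delta_N \<mu> N G G" if G: "G \<in> V" for G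
  proof -
    have G_T: "G \<in> topspace T"
      using G V(1) openin_subset by blast
    have S_G: "S M x \<le> oscillation N G G x + e" for x
      unfolding S_def
    proof (rule cSUP_least[OF I(2)], clarify)
      fix n m assume "(n, m) \<in> I M"
      then have nm: "max N 1 \<le> n" "n \<le> max N 1 + M" "max N 1 \<le> m" "m \<le> max N 1 + M"
        by (auto simp: I_def)
      have "empirical_dist F F n m x x \<le> empirical_dist F G n n x x + empirical_dist G F n m x x"
        using nm by (intro empirical_dist_triangle) auto
      also have "empirical_dist G F n m x x \<le> empirical_dist G G n m x x + empirical_dist G F m m x x"
        using nm by (intro empirical_dist_triangle) auto
      also have "empirical_dist G F m m x x = empirical_dist F G m m x x"
        using nm by (intro empirical_dist_commute) auto
      also have "empirical_dist G G n m x x \<le> oscillation N G G x"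
        using nm by (intro empirical_dist_le_oscillation) auto
      finally show "empirical_dist F F n m x x \<le> oscillation N G G x + e"
        using V(3)[OF G, of n x] V(3)[OF G, of m x] nm by simp
    qed
    have "integrable \<mu> (S M)"
      using S_nonneg order_trans[OF S_le oscillation_le_diameter]
      by (intro integrable_const_bound[of _ "diameter (UNIV :: 'a set)"] AE_I2) auto
    then have "(\<integral>x. S M x \<partial>\<mu>) \<le> (\<integral>x. oscillation N G G x + e \<partial>\<mu>)"
      using S_G by (intro integral_mono Bochner_Integration.integrable_add integrable_oscillation G_T integrable_const)
    also have "\<dots> = Delta_N \<mu> N G G + e"
      unfolding Delta_N_eq by (simp add: Bochner_Integration.integral_add integrable_oscillation G_T prob_space)
    finally show ?thesis
      using M by (simp add: e_def field_simps)
  qed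
  then have "V \<subseteq> {F \<in> topspace T. c < Delta_N \<mu> N F F}"
    using openin_subset[OF V(1)] by auto
  with V show "\<exists>V. openin T V \<and> F \<in> V \<and> V \<subseteq> {F \<in> topspace T. c < Delta_N \<mu> N F F}"
    by blast
qed

section \<open>Open dense sets of maps with large oscillation\<close>

text \<open>
  Any constant between 0 and \<open>c / 2\<close> could replace \<open>c / 3\<close>: density needs that twice the constant is less
  than \<open>c\<close>. The second set of the union is there for density at maps with small instability.
\<close>

definition witnesses :: "real \<Rightarrow> nat \<Rightarrow> ('a \<Rightarrow> 'a) set" where
  "witnesses c N = {f \<in> topspace T. c / 3 < Delta_N \<mu> N f f} \<union> {f \<in> topspace T. Delta \<mu> T f < c}"

lemma openin_witnesses: "openin T (witnesses c N)"
  unfolding witnesses_def by (intro openin_Un openin_Delta_N_self_greater openin_Delta_less)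

text \<open>
  If a neighbourhood of \<open>f\<close> contained no witness, all its self-oscillations would be at most \<open>c / 3\<close>, so
  \<open>Delta\<close> would be at most \<open>2 * c / 3\<close> at \<open>f\<close>, which would make \<open>f\<close> itself a witness.
\<close>

lemma dense_witnesses:
  assumes "c > 0"
  shows "T closure_of witnesses c N = topspace T"
proof (rule equalityI[OF closure_of_subset_topspace], rule subsetI)
  fix f assume f: "f \<in> topspace T"
  show "f \<in> T closure_of witnesses c N"
    unfolding in_closure_of
  proof (intro conjI f allI impI; elim conjE)
    fix V assume V: "f \<in> V" "openin T V"
    show "\<exists>F. F \<in> witnesses c N \<and> F \<in> V"
    proof (rule ccontr)
      assume *: "\<not> (\<exists>F. F \<in> witnesses c N \<and> F \<in> V)"
      have "Delta_N \<mu> N F F \<le> c / 3" if "F \<in> V" for F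
        using * that openin_subset[OF V(2)] by (force simp: witnesses_def)
      then have "Delta \<mu> T f \<le> 2 * (c / 3)"
        by (rule Delta_le_if_self_oscillation_le[OF V(2,1)])
      also have "\<dots> < c" using \<open>c > 0\<close> by simp
      finally have "f \<in> witnesses c N"
        using f by (simp add: witnesses_def)
      with V * show False by blast
    qed
  qed
qed

lemma non_statistical_if_in_witnesses:
  assumes f: "f \<in> topspace T" "0 < Delta \<mu> T f"
    and wit: "\<And>k N. f \<in> witnesses (1 / Suc k) N"
  shows "non_statistical \<mu> f"
proof -
  obtain k where k: "1 / real (Suc k) < Delta \<mu> T f"
    using reals_Archimedean[OF f(2)] by (auto simp: inverse_eq_divide)
  have "1 / real (Suc k) / 3 \<le> Delta_N \<mu> N f f" for N
    using wit[of k N] k by (auto simp: witnesses_def)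
  then show ?thesis
    by (intro non_statistical_if_Delta_N_bounded_below[OF f(1), of "1 / real (Suc k) / 3"]) auto
qed

end

theorem theoremB:
  fixes \<mu> :: "'a :: compact_metric_space measure"
    and \<Lambda> U :: "('a \<Rightarrow> 'a) set"
    and T :: "('a \<Rightarrow> 'a) topology"
  assumes "\<mu> \<in> borel_prob_measures"
    and "\<Lambda> \<subseteq> {f. continuous_on UNIV f}"
    and "topspace T = \<Lambda>"
    and "finer_topology T (subtopology C0_topology \<Lambda>)"
    and "U = T interior_of {f \<in> \<Lambda>. statistically_unstable \<mu> T f}"
  shows "baire_generic_in (subtopology T U) {f \<in> U. non_statistical \<mu> f}"
proof -
  interpret map_family \<mu> T
    using assms by unfold_locales auto
  have U: "openin T U" and U_unstable: "U \<subseteq> {f \<in> topspace T. 0 < Delta \<mu> T f}"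
    using interior_of_subset[of T "{f \<in> \<Lambda>. statistically_unstable \<mu> T f}"]
    by (auto simp: assms(3,5) statistically_unstable_def)
  have topspace_U: "topspace (subtopology T U) = U"
    using openin_subset[OF U] by auto
  define \<G> where "\<G> = (\<lambda>(k :: nat, N). witnesses (1 / Suc k) N \<inter> U) ` UNIV"
  have "openin (subtopology T U) G \<and> subtopology T U closure_of G = U" if "G \<in> \<G>" for G
  proof -
    from that obtain k N where G: "G = witnesses (1 / Suc k) N \<inter> U"
      by (auto simp: \<G>_def)
    have "subtopology T U closure_of G = U \<inter> T closure_of (U \<inter> witnesses (1 / Suc k) N)"
      unfolding G by (simp add: closure_of_subtopology Int_ac)
    also have "\<dots> = U \<inter> T closure_of (U \<inter> T closure_of witnesses (1 / Suc k) N)"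
      by (simp add: closure_of_openin_Int_closure_of[OF U])
    also have "\<dots> = U"
      using openin_subset[OF U] closure_of_subset[of U T] by (auto simp: dense_witnesses Int_absorb2)
    finally show ?thesis
      unfolding G using openin_witnesses by (auto simp: openin_subtopology)
  qed
  moreover have "countable \<G>"
    unfolding \<G>_def by simp
  moreover have "U \<inter> \<Inter>\<G> \<subseteq> {f \<in> U. non_statistical \<mu> f}"
  proof
    fix f assume f: "f \<in> U \<inter> \<Inter>\<G>"
    then have "f \<in> witnesses (1 / Suc k) N" for k N
      by (auto simp: \<G>_def)
    with f U_unstable show "f \<in> {f \<in> U. non_statistical \<mu> f}"
      by (auto intro: non_statistical_if_in_witnesses)
  qed
  ultimately show ?thesis
    unfolding baire_generic_in_def topspace_U by blast
qed

end
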